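(* Assume the Riemann Hypothesis. Let $k$ be a positive even integer. There is a number $\epsilon_0=\epsilon_0(k)>0$ such that the following holds for all real $\epsilon,\epsilon_1$ with $\epsilon_0>\epsilon>\epsilon_1>0$. If $$\int_{1}^{X} (\psi(x+h)-\psi(x)-h)^k\, dx = \mu_k\, h^{k/2 + 1} \int_{E}^{X/h} \Bigl(\log\frac{x}{E}\Bigr)^{k/2} dx + O_k\bigl(h^{k/2} X^{1-\epsilon_1}\bigr)$$ holds uniformly for $X^{\epsilon} \leq h \leq X^{1-\epsilon}$, then there exists $\epsilon_2>0$ such that $$\int_{1}^{X} (\psi(x + \delta x) - \psi(x) - \delta x)^k\, dx = \frac{\mu_k}{\frac{k}{2}+1}\, X^{k/2+1} \delta^{k/2} \Bigl( \log\frac{1}{E\delta} \Bigr)^{k/2} + O_k\bigl(\delta^{k/2} X^{k/2+1-\epsilon_2}\bigr)$$ holds uniformly for $X^{-1 +2\epsilon + 2\epsilon_1} \leq \delta \leq X^{-\epsilon}/2$.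
   Context: $\psi(x)=\sum_{n\le x}\Lambda(n)$, where $\Lambda$ is the von Mangoldt function. For even $k$, $\mu_k = 1\cdot 3\cdot 5\cdots (k-1)$. $E=2\pi e^{C_0-1}$, where $C_0$ is Euler's constant. The estimates are for large $X$; "uniformly" means that the implied constant in $O_k(\cdot)$ does not depend on $X$ nor on $h$ (respectively $\delta$) in the stated range. The integer $k$ and the numbers $\epsilon,\epsilon_1$ are regarded as fixed. *)

theory Defs
  imports "HOL-Complex_Analysis.Complex_Analysis" "HOL-Number_Theory.Prime_Powers"
begin

definition is_riemann_zeta :: "(complex \<Rightarrow> complex) \<Rightarrow> bool" where
  "is_riemann_zeta \<zeta> \<longleftrightarrow>
     \<zeta> holomorphic_on (- {1}) \<and>
     (\<forall>s. Re s > 1 \<longrightarrow> (\<lambda>n. 1 / of_nat (Suc n) powr s) sums \<zeta> s)"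

lemma is_riemann_zeta_unique:
  assumes f: "is_riemann_zeta f" and g: "is_riemann_zeta g" and "s \<noteq> 1"
  shows "f s = g s"
proof (rule analytic_continuation_open[where f = f and g = g and s = "{z. Re z > 1}" and s' = "- {1}"])
  show "open {z. Re z > 1}" by (rule open_halfspace_Re_gt)
  show "{z. Re z > 1} \<noteq> {}" by (auto intro: exI[of _ 2])
  show "connected (- {1 :: complex})"
    by (rule connected_punctured_universe) simp
  show "f z = g z" if "z \<in> {z. Re z > 1}" for z
    using f g that by (auto simp: is_riemann_zeta_def intro: sums_unique2)
qed (use assms in \<open>auto simp: is_riemann_zeta_def\<close>)

text \<open>The zeta function is introduced through its defining property, as the analytic
  continuation of its Dirichlet series to the plane without \<open>1\<close>. By the lemma above there is at
  most one such function up to its (arbitrary) value at \<open>1\<close>, so that the existential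
  quantifier below only names it.\<close>

definition Riemann_Hypothesis :: bool where
  "Riemann_Hypothesis \<longleftrightarrow>
     (\<exists>\<zeta>. is_riemann_zeta \<zeta> \<and> (\<forall>s. 0 < Re s \<and> Re s < 1 \<and> \<zeta> s = 0 \<longrightarrow> Re s = 1 / 2))"

definition chebyshev_psi :: "real \<Rightarrow> real" where
  "chebyshev_psi x = (\<Sum>n | 0 < n \<and> real n \<le> x. mangoldt n)"

definition mu_moment :: "nat \<Rightarrow> real" where
  "mu_moment k = (\<Prod>j | odd j \<and> j < k. real j)"

definition E_const :: real where
  "E_const = 2 * pi * exp (euler_mascheroni - 1)"

end

theory Submission
  imports Defs "HOL-Real_Asymp.Real_Asymp"
begin

text \<open>
  Write \<open>f x h = psi_err x h\<close> for the error \<open>\<psi>(x + h) - \<psi>(x) - h\<close> and put \<open>k = 2 m\<close>. The hypothesis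
  evaluates \<open>\<integral> f x h ^ k dx\<close> for a length \<open>h\<close> that does not vary with \<open>x\<close>; the conclusion is about
  the length \<open>\<delta> x\<close>. The two are connected by averaging over the length. Cutting an interval in two gives

  \<open>f x (\<delta> x) = f x (\<delta> x + u) - f ((1 + \<delta>) x) u\<close>.

  Let \<open>u\<close> run over \<open>[0, \<delta> y]\<close>, where \<open>y = X powr (1 - \<eta>)\<close> and \<open>\<eta> = \<epsilon>1 / 2\<close>, so that \<open>u\<close> is
  shorter than the typical length \<open>\<delta> X\<close> by a power of \<open>X\<close>. Up to logarithms, the \<open>k\<close>-th moment of
  the last term is at most of order \<open>X (\<delta> y) ^ m\<close>, again by the hypothesis (by a trivial bound if \<open>u\<close> is too short for it), hence
  smaller by a power of \<open>X\<close> than the moment sought, and by the elementary inequality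
  \<open>power_diff_absorb\<close> it may be dropped (\<open>shifted_0_average\<close>).

  The remaining average of \<open>f x (\<delta> x + u) ^ k\<close> over \<open>x\<close> and \<open>u\<close> is a double integral of
  \<open>f x h ^ k\<close> over a thin strip along the line \<open>h = \<delta> x\<close>. Integrating over \<open>x\<close> first
  (\<open>integral_strip_swap\<close>) leaves, for each fixed \<open>h\<close>, an integral over
  \<open>x \<in> [h / \<delta> - y, h / \<delta>]\<close>, which is the difference of two moments given by the hypothesis. There
  \<open>x / h\<close> is nearly \<open>1 / \<delta>\<close>, so the integral is nearly \<open>\<mu> h ^ m y L ^ m\<close> with
  \<open>L = ln (1 / (E \<delta>))\<close> (\<open>strip_asymp\<close>). Integrating over \<open>h \<le> \<delta> X\<close> and dividing by the length
  \<open>\<delta> y\<close> of the average yields the main term \<open>\<mu> X ^ (m + 1) \<delta> ^ m L ^ m / (m + 1)\<close>.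

  Three effects have to be balanced. Differencing costs a factor \<open>X / y\<close> in the error of the
  hypothesis, which is admissible since it saves \<open>X powr \<epsilon>1\<close>. The variation of \<open>x / h\<close> costs the
  relative error \<open>y / X\<close>. Values of \<open>h\<close> near \<open>0\<close>, where the hypothesis is silent or the strip is not
  thin relative to \<open>h\<close>, contribute little because the moments there are small (\<open>moment_crude\<close>); the
  condition \<open>\<delta> \<ge> X powr (- 1 + 2 \<epsilon> + 2 \<epsilon>1)\<close> makes the trivial bound for lengths below
  \<open>X powr \<epsilon>\<close> strong enough for this. Every error saves at least \<open>X powr (\<epsilon>1 / 8)\<close> up to logarithms,
  and half of that exponent absorbs them.
\<close>

section \<open>The error term of the prime count in a short interval\<close>

definition psi_err :: "real \<Rightarrow> real \<Rightarrow> real" where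
  "psi_err x h = chebyshev_psi (x + h) - chebyshev_psi x - h"

lemma finite_nat_le_real: "finite {n::nat. 0 < n \<and> real n \<le> x}"
proof (rule finite_subset)
  show "{n::nat. 0 < n \<and> real n \<le> x} \<subseteq> {..nat \<lfloor>x\<rfloor>}"
    by (auto simp: le_nat_floor)
qed simp

lemma mono_chebyshev_psi: "mono chebyshev_psi"
  unfolding chebyshev_psi_def
  by (intro monoI sum_mono2) (auto simp: mangoldt_nonneg finite_nat_le_real)

lemma chebyshev_psi_nonneg: "chebyshev_psi x \<ge> 0"
  unfolding chebyshev_psi_def by (intro sum_nonneg mangoldt_nonneg)

lemma borel_measurable_chebyshev_psi [measurable]: "chebyshev_psi \<in> borel_measurable borel"
  by (rule borel_measurable_mono[OF mono_chebyshev_psi])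

lemma borel_measurable_psi_err [measurable (raw)]:
  assumes [measurable]: "f \<in> borel_measurable M" "g \<in> borel_measurable M"
  shows "(\<lambda>z. psi_err (f z) (g z)) \<in> borel_measurable M"
  unfolding psi_err_def by measurable

lemma psi_err_pow_bounded:
  assumes "x \<le> R" "0 \<le> h" "h \<le> R"
  shows "\<bar>psi_err x h ^ k\<bar> \<le> (chebyshev_psi (2 * R) + R) ^ k"
proof -
  have "chebyshev_psi (x + h) \<le> chebyshev_psi (2 * R)" "chebyshev_psi x \<le> chebyshev_psi (x + h)"
    using assms by (auto intro!: monoD[OF mono_chebyshev_psi])
  then have "\<bar>psi_err x h\<bar> \<le> chebyshev_psi (2 * R) + R"
    using assms chebyshev_psi_nonneg[of x] unfolding psi_err_def by linarith
  then show ?thesis by (simp add: power_abs power_mono)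
qed

text \<open>
  At most \<open>u + 1\<close> integers lie in \<open>(y, y + u]\<close>, and \<open>mangoldt n \<le> ln n\<close> for each of them.
\<close>

lemma chebyshev_psi_short_le:
  assumes "1 \<le> y" "0 \<le> u"
  shows "chebyshev_psi (y + u) - chebyshev_psi y \<le> (u + 1) * ln (y + u)"
proof -
  let ?A = "{n::nat. 0 < n \<and> real n \<le> y + u}" and ?B = "{n::nat. 0 < n \<and> real n \<le> y}"
  have sub: "?B \<subseteq> ?A" using assms by auto
  have "chebyshev_psi (y + u) - chebyshev_psi y = (\<Sum>n\<in>?A - ?B. mangoldt n :: real)"
    unfolding chebyshev_psi_def
    using sum.subset_diff[OF sub finite_nat_le_real, of "mangoldt :: nat \<Rightarrow> real"] by simp
  also have "\<dots> \<le> (\<Sum>n\<in>?A - ?B. ln (y + u))"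
  proof (rule sum_mono)
    fix n assume n: "n \<in> ?A - ?B"
    then have "mangoldt n \<le> ln (real n)" by (intro mangoldt_le) auto
    also have "\<dots> \<le> ln (y + u)" using n by simp
    finally show "mangoldt n \<le> ln (y + u)" .
  qed
  also have "\<dots> = real (card (?A - ?B)) * ln (y + u)" by simp
  also have "\<dots> \<le> (u + 1) * ln (y + u)"
  proof (rule mult_right_mono)
    have "?A - ?B \<subseteq> {nat \<lfloor>y\<rfloor><..nat \<lfloor>y + u\<rfloor>}"
      using assms by (auto simp: le_nat_floor nat_less_iff floor_less_iff)
    then have "card (?A - ?B) \<le> nat \<lfloor>y + u\<rfloor> - nat \<lfloor>y\<rfloor>"
      using card_mono[of "{nat \<lfloor>y\<rfloor><..nat \<lfloor>y + u\<rfloor>}" "?A - ?B"] by simp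
    then have "int (card (?A - ?B)) \<le> \<lfloor>y + u\<rfloor> - \<lfloor>y\<rfloor>"
      using assms floor_mono[of y "y + u"] by linarith
    then show "real (card (?A - ?B)) \<le> u + 1" by linarith
    show "0 \<le> ln (y + u)" using assms by simp
  qed
  finally show ?thesis .
qed

lemma psi_err_trivial_bound:
  assumes "1 \<le> y" "0 \<le> u"
  shows "\<bar>psi_err y u\<bar> \<le> (u + 1) * (1 + ln (y + u))"
proof -
  have "chebyshev_psi y \<le> chebyshev_psi (y + u)"
    using assms by (auto intro!: monoD[OF mono_chebyshev_psi])
  moreover have "0 \<le> (u + 1) * ln (y + u)" using assms by simp
  ultimately have "\<bar>psi_err y u\<bar> \<le> (u + 1) * ln (y + u) + (u + 1)"
    using chebyshev_psi_short_le[OF assms] assms unfolding psi_err_def by linarith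
  then show ?thesis by (simp add: algebra_simps)
qed

lemma bounded_borel_set_integrable:
  fixes f :: "real \<Rightarrow> real"
  assumes [measurable]: "f \<in> borel_measurable borel"
    and "\<And>x. a \<le> x \<Longrightarrow> x \<le> b \<Longrightarrow> \<bar>f x\<bar> \<le> B"
  shows "set_integrable lborel {a..b} f"
  unfolding set_integrable_def
  by (rule integrableI_bounded_set_indicator[where B = B])
     (use assms in \<open>auto simp: emeasure_lborel_Icc_eq\<close>)

lemma psi_err_pow_set_integrable:
  fixes c d :: "real \<Rightarrow> real"
  assumes [measurable]: "c \<in> borel_measurable borel" "d \<in> borel_measurable borel"
    and "\<And>x. a \<le> x \<Longrightarrow> x \<le> b \<Longrightarrow> c x \<le> R \<and> 0 \<le> d x \<and> d x \<le> R"
  shows "set_integrable lborel {a..b} (\<lambda>x. psi_err (c x) (d x) ^ k)"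
  by (rule bounded_borel_set_integrable[where B = "(chebyshev_psi (2 * R) + R) ^ k"])
     (use assms psi_err_pow_bounded in auto)

lemma psi_err_pow_integrable:
  fixes c d :: "real \<Rightarrow> real"
  assumes "c \<in> borel_measurable borel" "d \<in> borel_measurable borel"
    and "\<And>x. a \<le> x \<Longrightarrow> x \<le> b \<Longrightarrow> c x \<le> R \<and> 0 \<le> d x \<and> d x \<le> R"
  shows "(\<lambda>x. psi_err (c x) (d x) ^ k) integrable_on {a..b}"
  using set_borel_integral_eq_integral(1)[OF psi_err_pow_set_integrable[OF assms]] .

lemma psi_err_pow_integrable_const [intro]:
  assumes "0 \<le> h"
  shows "(\<lambda>x. psi_err x h ^ k) integrable_on {a..b}"
  by (rule psi_err_pow_integrable[where R = "max b h"]) (use assms in auto)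


section \<open>Two tools for comparing moments\<close>

text \<open>
  This replaces Minkowski's inequality: integrated, it says that adding a function \<open>r\<close> of small
  \<open>k\<close>-th moment to \<open>g\<close> hardly changes the \<open>k\<close>-th moment of \<open>g\<close>, with a parameter \<open>\<theta>\<close> still to be
  chosen. Where \<open>r\<close> is at most \<open>\<theta> g\<close> in absolute value, the Lipschitz bound for the power gives the
  first term; elsewhere \<open>g\<close> is at most \<open>r / \<theta>\<close>, and both powers are bounded by the second one.
\<close>

lemma power_diff_absorb:
  fixes g r \<theta> :: real
  assumes "even k" "k > 0" "0 < \<theta>" "\<theta> \<le> 1"
  shows "\<bar>(g - r) ^ k - g ^ k\<bar> \<le> real k * 2 ^ k * (\<theta> * g ^ k + r ^ k / \<theta> ^ k)"
proof (cases "\<bar>r\<bar> \<le> \<theta> * \<bar>g\<bar>")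
  case True
  show ?thesis
  proof (cases "g = 0")
    case g0: True
    with True have "r = 0" by simp
    with g0 show ?thesis using assms by simp
  next
    case False
    \<comment> \<open>Dividing by \<open>s\<close> puts both numbers into the unit ball, where powers are Lipschitz with constant \<open>k\<close>.\<close>
    define s where "s = 2 * \<bar>g\<bar>"
    have s: "s > 0" using False by (simp add: s_def)
    have "\<bar>r\<bar> \<le> \<bar>g\<bar>" using True assms mult_right_mono[of \<theta> 1 "\<bar>g\<bar>"] by simp
    then have "norm ((g - r) / s) \<le> 1" "norm (g / s) \<le> 1"
      using s by (auto simp: s_def divide_simps)
    then have "norm (((g - r) / s) ^ k - (g / s) ^ k) \<le> real k * norm ((g - r) / s - g / s)"
      by (rule norm_power_diff)
    also have "(g - r) / s - g / s = - (r / s)" using s by (simp add: field_simps)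
    also have "((g - r) / s) ^ k - (g / s) ^ k = ((g - r) ^ k - g ^ k) / s ^ k"
      by (simp add: power_divide flip: diff_divide_distrib)
    finally have "\<bar>(g - r) ^ k - g ^ k\<bar> \<le> s ^ k * (real k * (\<bar>r\<bar> / s))"
      using s by (simp add: divide_simps mult_ac)
    also have "\<bar>r\<bar> / s \<le> \<theta>" using True s assms mult_nonneg_nonneg[of \<theta> "\<bar>g\<bar>"]
      by (simp add: s_def divide_simps)
    then have "s ^ k * (real k * (\<bar>r\<bar> / s)) \<le> s ^ k * (real k * \<theta>)"
      using s by (intro mult_left_mono) auto
    also have "\<dots> = real k * 2 ^ k * (\<theta> * g ^ k)"
      using assms by (simp add: s_def power_mult_distrib power_even_abs)
    also have "\<dots> \<le> real k * 2 ^ k * (\<theta> * g ^ k + r ^ k / \<theta> ^ k)"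
      using assms by (intro mult_left_mono) (auto simp: zero_le_even_power)
    finally show ?thesis .
  qed
next
  case False
  then have g: "\<bar>g\<bar> \<le> \<bar>r\<bar> / \<theta>" using assms by (simp add: field_simps)
  have "\<bar>r\<bar> \<le> \<bar>r\<bar> / \<theta>" using assms mult_right_mono[of \<theta> 1 "\<bar>r\<bar>"] by (simp add: field_simps)
  then have "\<bar>g - r\<bar> \<le> 2 * (\<bar>r\<bar> / \<theta>)" using g by linarith
  then have "\<bar>g - r\<bar> ^ k \<le> (2 * (\<bar>r\<bar> / \<theta>)) ^ k" by (intro power_mono) auto
  moreover have "\<bar>g\<bar> ^ k \<le> (2 * (\<bar>r\<bar> / \<theta>)) ^ k" using g assms by (intro power_mono) auto
  ultimately have "\<bar>\<bar>g - r\<bar> ^ k - \<bar>g\<bar> ^ k\<bar> \<le> (2 * (\<bar>r\<bar> / \<theta>)) ^ k"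
    using zero_le_power[of "\<bar>g - r\<bar>" k] zero_le_power[of "\<bar>g\<bar>" k] by linarith
  also have "\<dots> = 1 * 2 ^ k * (r ^ k / \<theta> ^ k)"
    using assms by (simp add: power_mult_distrib power_divide power_even_abs)
  also have "\<dots> \<le> real k * 2 ^ k * (r ^ k / \<theta> ^ k)"
    using assms by (intro mult_right_mono) (auto simp: zero_le_even_power)
  also have "\<dots> \<le> real k * 2 ^ k * (\<theta> * g ^ k + r ^ k / \<theta> ^ k)"
    using assms by (intro mult_left_mono) (auto simp: zero_le_even_power)
  finally show ?thesis using assms by (simp add: power_even_abs)
qed

text \<open>
  The substitution \<open>h = \<delta> x + u\<close> turns the rectangle \<open>a \<le> x \<le> b, 0 \<le> u \<le> U\<close> into a strip along the
  line \<open>h = \<delta> x\<close>, whose section at height \<open>h\<close> is the interval in \<open>D\<close>. Since \<open>a\<close> is nonnegative, all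
  nonempty sections have \<open>0 \<le> h \<le> \<delta> b + U\<close>. The proof applies Fubini's theorem for the Lebesgue integral
  on both sides of a translation in \<open>u\<close> for fixed \<open>x\<close>.
\<close>

lemma integral_strip_swap:
  fixes G :: "real \<Rightarrow> real \<Rightarrow> real"
  assumes meas: "case_prod G \<in> borel_measurable (borel \<Otimes>\<^sub>M borel)"
    and bound: "\<And>x h. a \<le> x \<Longrightarrow> x \<le> b \<Longrightarrow> 0 \<le> h \<Longrightarrow> h \<le> \<delta> * b + U \<Longrightarrow> \<bar>G x h\<bar> \<le> B"
    and pos: "0 \<le> a" "0 < \<delta>" "0 \<le> U"
  defines "S \<equiv> (\<lambda>u. integral {a..b} (\<lambda>x. G x (\<delta> * x + u)))"
    and "D \<equiv> (\<lambda>h. integral {max a ((h - U) / \<delta>)..min b (h / \<delta>)} (\<lambda>x. G x h))"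
  shows "S integrable_on {0..U}" "D integrable_on {0..\<delta> * b + U}"
    "integral {0..U} S = integral {0..\<delta> * b + U} D"
proof -
  have [measurable]: "(\<lambda>z. G (f z) (g z)) \<in> borel_measurable M"
    if [measurable]: "f \<in> borel_measurable M" "g \<in> borel_measurable M" for f g and M :: "'z measure"
  proof -
    have "(\<lambda>z. case_prod G (f z, g z)) \<in> borel_measurable M"
      by (rule measurable_compose[OF _ meas]) measurable
    then show ?thesis by simp
  qed
  define \<Phi> where "\<Phi> = (\<lambda>x h. (if a \<le> x \<and> x \<le> b \<and> 0 \<le> h - \<delta> * x \<and> h - \<delta> * x \<le> U then G x h else 0))"
  define \<Psi> where "\<Psi> = (\<lambda>x u. (if a \<le> x \<and> x \<le> b \<and> 0 \<le> u \<and> u \<le> U then G x (\<delta> * x + u) else 0))"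
  have "\<delta> * x \<le> \<delta> * b" if "x \<le> b" for x using that pos by (intro mult_left_mono) auto
  moreover have "0 \<le> \<delta> * x" if "a \<le> x" for x using that pos by (intro mult_nonneg_nonneg) auto
  ultimately have range: "0 \<le> \<delta> * x + u \<and> \<delta> * x + u \<le> \<delta> * b + U"
    if "a \<le> x" "x \<le> b" "0 \<le> u" "u \<le> U" for x u
    using that by (smt (verit))
  have range': "0 \<le> h \<and> h \<le> \<delta> * b + U"
    if "a \<le> x" "x \<le> b" "0 \<le> h - \<delta> * x" "h - \<delta> * x \<le> U" for x h
    using range[OF that] by simp
  have fin: "emeasure (lborel \<Otimes>\<^sub>M lborel) ({a..b} \<times> {c..d}) < \<infinity>" for c d :: real
    by (subst lborel.emeasure_pair_measure_Times) (auto simp: ennreal_mult_less_top emeasure_lborel_Icc_eq)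
  have bound': "\<bar>G x h\<bar> \<le> \<bar>B\<bar>" if "a \<le> x" "x \<le> b" "0 \<le> h" "h \<le> \<delta> * b + U" for x h
    using bound[OF that] by linarith
  have "\<bar>\<Phi> x h\<bar> \<le> \<bar>B\<bar>" for x h
    using bound'[of x h] range'[of x h] by (auto simp: \<Phi>_def)
  moreover have zero1: "\<Phi> x h = 0" if "(x, h) \<notin> {a..b} \<times> {0..\<delta> * b + U}" for x h
    using that range'[of x h] by (auto simp: \<Phi>_def)
  moreover have "case_prod \<Phi> \<in> borel_measurable (lborel \<Otimes>\<^sub>M lborel)"
    unfolding \<Phi>_def by measurable
  ultimately have int\<Phi>: "integrable (lborel \<Otimes>\<^sub>M lborel) (case_prod \<Phi>)"
    by (intro integrableI_bounded_set[where A = "{a..b} \<times> {0..\<delta> * b + U}" and B = "\<bar>B\<bar>"] AE_I2)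
       (use fin in \<open>auto simp: split_beta simp del: mem_Times_iff intro!: zero1\<close>)
  have "\<bar>\<Psi> x u\<bar> \<le> \<bar>B\<bar>" for x u
    using bound'[of x "\<delta> * x + u"] range[of x u] by (auto simp: \<Psi>_def)
  moreover have zero2: "\<Psi> x u = 0" if "(x, u) \<notin> {a..b} \<times> {0..U}" for x u
    using that by (auto simp: \<Psi>_def)
  moreover have "case_prod \<Psi> \<in> borel_measurable (lborel \<Otimes>\<^sub>M lborel)"
    unfolding \<Psi>_def by measurable
  ultimately have int\<Psi>: "integrable (lborel \<Otimes>\<^sub>M lborel) (case_prod \<Psi>)"
    by (intro integrableI_bounded_set[where A = "{a..b} \<times> {0..U}" and B = "\<bar>B\<bar>"] AE_I2)
       (use fin in \<open>auto simp: split_beta simp del: mem_Times_iff intro!: zero2\<close>)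
  have S: "(\<integral>x. \<Psi> x u \<partial>lborel) = indicator {0..U} u * S u" for u
  proof (cases "u \<in> {0..U}")
    case True
    have "set_integrable lborel {a..b} (\<lambda>x. G x (\<delta> * x + u))"
      by (rule bounded_borel_set_integrable[where B = B]) (use True bound range in auto)
    note * = set_borel_integral_eq_integral(2)[OF this]
    have "(\<integral>x. \<Psi> x u \<partial>lborel) = (LINT x:{a..b}|lborel. G x (\<delta> * x + u))"
      unfolding set_lebesgue_integral_def
      by (rule Bochner_Integration.integral_cong) (use True in \<open>auto simp: \<Psi>_def indicator_def\<close>)
    then show ?thesis using True * unfolding S_def by simp
  qed (auto simp: \<Psi>_def)
  have D: "(\<integral>x. \<Phi> x h \<partial>lborel) = indicator {0..\<delta> * b + U} h * D h" for h
  proof (cases "h \<in> {0..\<delta> * b + U}")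
    case True
    have eq: "x \<in> {max a ((h - U) / \<delta>)..min b (h / \<delta>)} \<longleftrightarrow> a \<le> x \<and> x \<le> b \<and> 0 \<le> h - \<delta> * x \<and> h - \<delta> * x \<le> U" for x
      using pos by (auto simp: field_simps)
    have "set_integrable lborel {max a ((h - U) / \<delta>)..min b (h / \<delta>)} (\<lambda>x. G x h)"
      by (rule bounded_borel_set_integrable[where B = B]) (use True bound in auto)
    note * = set_borel_integral_eq_integral(2)[OF this]
    have "(\<integral>x. \<Phi> x h \<partial>lborel) =
      (LINT x:{max a ((h - U) / \<delta>)..min b (h / \<delta>)}|lborel. G x h)"
      unfolding set_lebesgue_integral_def \<Phi>_def indicator_def eq
      by (rule Bochner_Integration.integral_cong) auto
    then show ?thesis using True * unfolding D_def by simp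
  next
    case False
    then have "\<Phi> x h = 0" for x using range'[of x h] by (auto simp: \<Phi>_def)
    then show ?thesis using False by simp
  qed
  have sw: "integrable lborel (\<lambda>u. \<integral>x. \<Psi> x u \<partial>lborel)" "integrable lborel (\<lambda>h. \<integral>x. \<Phi> x h \<partial>lborel)"
    by (rule lborel_pair.integrable_snd[OF int\<Psi>], rule lborel_pair.integrable_snd[OF int\<Phi>])
  have Sint: "set_integrable lborel {0..U} S" and Dint: "set_integrable lborel {0..\<delta> * b + U} D"
    using sw unfolding S D set_integrable_def by simp_all
  show "S integrable_on {0..U}" "D integrable_on {0..\<delta> * b + U}"
    using set_borel_integral_eq_integral(1) Sint Dint by auto
  have "integral {0..U} S = (\<integral>u. \<integral>x. \<Psi> x u \<partial>lborel \<partial>lborel)"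
    using set_borel_integral_eq_integral(2)[OF Sint] unfolding set_lebesgue_integral_def S by simp
  also have "\<dots> = (\<integral>x. \<integral>u. \<Psi> x u \<partial>lborel \<partial>lborel)"
    by (rule lborel_pair.Fubini_integral[OF int\<Psi>])
  also have "\<dots> = (\<integral>x. \<integral>h. \<Phi> x h \<partial>lborel \<partial>lborel)"
  proof (rule Bochner_Integration.integral_cong[OF refl])
    fix x
    have "(\<integral>h. \<Phi> x h \<partial>lborel) = (\<integral>u. \<Phi> x (\<delta> * x + 1 * u) \<partial>lborel)"
      using lborel_integral_real_affine[of 1 "\<Phi> x" "\<delta> * x"] by simp
    also have "\<dots> = (\<integral>u. \<Psi> x u \<partial>lborel)" by (simp add: \<Phi>_def \<Psi>_def)
    finally show "(\<integral>u. \<Psi> x u \<partial>lborel) = (\<integral>h. \<Phi> x h \<partial>lborel)" ..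
  qed
  also have "\<dots> = (\<integral>h. \<integral>x. \<Phi> x h \<partial>lborel \<partial>lborel)"
    by (rule lborel_pair.Fubini_integral[OF int\<Phi>, symmetric])
  also have "\<dots> = integral {0..\<delta> * b + U} D"
    using set_borel_integral_eq_integral(2)[OF Dint] unfolding set_lebesgue_integral_def D by simp
  finally show "integral {0..U} S = integral {0..\<delta> * b + U} D" .
qed

section \<open>Moments over intervals of fixed length\<close>

definition moment :: "nat \<Rightarrow> real \<Rightarrow> real \<Rightarrow> real" where
  "moment k X h = integral {1..X} (\<lambda>x. psi_err x h ^ k)"

definition moment_main :: "nat \<Rightarrow> real \<Rightarrow> real \<Rightarrow> real" where
  "moment_main k X h = mu_moment k * h ^ (k div 2 + 1) *
     integral {E_const..X / h} (\<lambda>x. ln (x / E_const) ^ (k div 2))"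

lemma E_const_ge_1: "E_const \<ge> 1"
proof -
  have "exp (1 :: real) \<le> 3" by (rule exp_le)
  then have "1 / 3 \<le> exp (- 1 :: real)" by (simp add: exp_minus field_simps)
  also have "\<dots> \<le> exp (euler_mascheroni - 1)" using euler_mascheroni_pos by simp
  finally have "2 * 3 * (1 / 3) \<le> 2 * pi * exp (euler_mascheroni - 1)"
    using pi_gt3 by (intro mult_mono) auto
  then show ?thesis unfolding E_const_def by simp
qed

lemma E_const_pos: "E_const > 0"
  using E_const_ge_1 by linarith

lemma mu_moment_nonneg: "mu_moment k \<ge> 0"
  unfolding mu_moment_def by (intro prod_nonneg) auto

lemma ln_pow_integrable:
  assumes "0 < a"
  shows "(\<lambda>x. ln (x / E_const) ^ m) integrable_on {a..b}"
  using assms E_const_pos by (intro integrable_continuous_interval continuous_intros) auto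

lemma integral_ln_pow_bounds:
  assumes "E_const \<le> a" "a \<le> b"
  shows "(b - a) * ln (a / E_const) ^ m \<le> integral {a..b} (\<lambda>x. ln (x / E_const) ^ m)"
    and "integral {a..b} (\<lambda>x. ln (x / E_const) ^ m) \<le> (b - a) * ln (b / E_const) ^ m"
proof -
  have a: "a > 0" using assms E_const_pos by linarith
  have ln0: "0 \<le> ln (x / E_const)" if "a \<le> x" for x
    using that assms E_const_pos by (simp add: field_simps)
  have "integral {a..b} (\<lambda>_. ln (a / E_const) ^ m) \<le> integral {a..b} (\<lambda>x. ln (x / E_const) ^ m)"
    using ln0 a E_const_pos
    by (intro integral_le ln_pow_integrable power_mono) (auto simp: field_simps)
  then show "(b - a) * ln (a / E_const) ^ m \<le> integral {a..b} (\<lambda>x. ln (x / E_const) ^ m)"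
    using assms by simp
  have "integral {a..b} (\<lambda>x. ln (x / E_const) ^ m) \<le> integral {a..b} (\<lambda>_. ln (b / E_const) ^ m)"
    using ln0 a E_const_pos
    by (intro integral_le ln_pow_integrable power_mono) (auto simp: field_simps)
  then show "integral {a..b} (\<lambda>x. ln (x / E_const) ^ m) \<le> (b - a) * ln (b / E_const) ^ m"
    using assms by simp
qed

text \<open>
  The integrand is at most \<open>ln Z ^ (k div 2)\<close> on an interval of length at most \<open>Z / h\<close>. If
  \<open>Z / h < E_const\<close>, then the integral runs over an empty interval and the main term vanishes.
\<close>

lemma moment_main_le:
  assumes "1 \<le> h" "1 \<le> Z"
  shows "moment_main k Z h \<le> mu_moment k * h ^ (k div 2) * Z * ln Z ^ (k div 2)"
proof (cases "E_const \<le> Z / h")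
  case True
  let ?m = "k div 2"
  have "integral {E_const..Z / h} (\<lambda>x. ln (x / E_const) ^ ?m) \<le> (Z / h - E_const) * ln (Z / h / E_const) ^ ?m"
    using True by (intro integral_ln_pow_bounds) auto
  also have "\<dots> \<le> (Z / h) * ln Z ^ ?m"
  proof (intro mult_mono power_mono)
    have "1 * 1 \<le> h * E_const" using assms E_const_ge_1 by (intro mult_mono) auto
    then have "Z / h / E_const \<le> Z"
      using assms E_const_pos mult_left_mono[of 1 "h * E_const" Z] by (simp add: field_simps)
    moreover have "0 < Z / h / E_const" using assms E_const_pos by simp
    ultimately show "ln (Z / h / E_const) \<le> ln Z" using assms by simp
    have "1 \<le> Z / h / E_const" using True E_const_pos by (subst le_divide_eq_1_pos) auto
    then show "0 \<le> ln (Z / h / E_const)" by (rule ln_ge_zero)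
    then show "0 \<le> ln (Z / h / E_const) ^ ?m" by simp
  qed (use assms E_const_pos in auto)
  finally have "moment_main k Z h \<le> mu_moment k * h ^ (?m + 1) * ((Z / h) * ln Z ^ ?m)"
    unfolding moment_main_def using assms mu_moment_nonneg by (intro mult_left_mono) auto
  also have "\<dots> = mu_moment k * h ^ ?m * Z * ln Z ^ ?m" using assms by simp
  finally show ?thesis .
next
  case False
  then have "moment_main k Z h = 0" by (simp add: moment_main_def)
  then show ?thesis using assms mu_moment_nonneg[of k] by simp
qed

text \<open>
  The hypothesis of the theorem for one choice of exponents and one implied constant. Constants
  defined in this locale depend on nothing else, which is the uniformity claimed in the conclusion.
\<close>

locale short_interval_moments =
  fixes k :: nat and \<epsilon> \<epsilon>1 C X0 :: real
  assumes k: "even k" "k > 0"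
    and eps: "0 < \<epsilon>1" "\<epsilon>1 < \<epsilon>" "\<epsilon> < 1 / 2"
    and C: "0 \<le> C" and X0: "1 \<le> X0"
    and asymp: "X0 \<le> X \<Longrightarrow> X powr \<epsilon> \<le> h \<Longrightarrow> h \<le> X powr (1 - \<epsilon>) \<Longrightarrow>
      \<bar>moment k X h - moment_main k X h\<bar> \<le> C * (h ^ (k div 2) * X powr (1 - \<epsilon>1))"
begin

abbreviation m :: nat where "m \<equiv> k div 2"

abbreviation \<mu> :: real where "\<mu> \<equiv> mu_moment k"

lemma m: "k = 2 * m" "m \<ge> 1" "m \<le> k"
  using k by auto

lemma psi_err_pow_nonneg: "0 \<le> psi_err x h ^ k"
  using k by (simp add: zero_le_even_power)

definition crude_const :: real where "crude_const = \<mu> + C + 4 ^ k"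

lemma crude_const_nonneg: "crude_const \<ge> 0"
  using C mu_moment_nonneg[of k] by (simp add: crude_const_def)

text \<open>
  An upper bound of the right order up to logarithms that also covers lengths below \<open>Z powr \<epsilon>\<close>, on
  which the hypothesis is silent. For them the trivial bound gives about \<open>Z * (Z powr \<epsilon>) ^ k\<close>, and
  \<open>(Z powr \<epsilon>) ^ k = (Z powr (2 * \<epsilon>)) ^ m\<close>; this is why \<open>H\<close> is required to be at least
  \<open>Z powr (2 * \<epsilon>)\<close>.
\<close>

lemma moment_crude:
  assumes "X0 \<le> Z" "0 \<le> h" "h \<le> H" "Z powr (2 * \<epsilon>) \<le> H" "h \<le> Z powr (1 - \<epsilon>)"
  shows "moment k Z h \<le> crude_const * Z * (1 + ln Z) ^ k * H ^ m"
proof -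
  have Z: "1 \<le> Z" using assms X0 by linarith
  have H: "0 \<le> H" using assms by linarith
  have lnZ: "0 \<le> ln Z" using Z by simp
  show ?thesis
  proof (cases "Z powr \<epsilon> \<le> h")
    case True
    have h1: "1 \<le> h" using True ge_one_powr_ge_zero[OF Z, of \<epsilon>] eps by linarith
    have T: "ln Z ^ m \<le> (1 + ln Z) ^ k" "1 \<le> (1 + ln Z) ^ k"
    proof -
      have "ln Z ^ m \<le> (1 + ln Z) ^ m" using lnZ by (intro power_mono) auto
      also have "\<dots> \<le> (1 + ln Z) ^ k" using lnZ m by (intro power_increasing) auto
      finally show "ln Z ^ m \<le> (1 + ln Z) ^ k" .
      show "1 \<le> (1 + ln Z) ^ k" using lnZ by simp
    qed
    have hH: "h ^ m \<le> H ^ m" using assms by (intro power_mono) auto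
    have "moment k Z h \<le> moment_main k Z h + C * (h ^ m * Z powr (1 - \<epsilon>1))"
      using asymp[OF assms(1) True assms(5)] by linarith
    also have "\<dots> \<le> \<mu> * h ^ m * Z * ln Z ^ m + C * (h ^ m * Z powr 1)"
      using moment_main_le[OF h1 Z, of k] Z eps C h1
      by (intro add_mono mult_left_mono powr_mono) auto
    also have "\<dots> \<le> \<mu> * H ^ m * Z * (1 + ln Z) ^ k + C * (H ^ m * Z * (1 + ln Z) ^ k)"
    proof (rule add_mono)
      show "\<mu> * h ^ m * Z * ln Z ^ m \<le> \<mu> * H ^ m * Z * (1 + ln Z) ^ k"
        using Z h1 hH T mu_moment_nonneg[of k] lnZ H by (intro mult_mono) auto
      have "h ^ m * Z * 1 \<le> H ^ m * Z * (1 + ln Z) ^ k"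
        using hH H Z T by (intro mult_mono) auto
      then show "C * (h ^ m * Z powr 1) \<le> C * (H ^ m * Z * (1 + ln Z) ^ k)"
        using Z C by (intro mult_left_mono) auto
    qed
    also have "\<dots> = (\<mu> + C) * (H ^ m * Z * (1 + ln Z) ^ k)" by (simp add: algebra_simps)
    also have "\<dots> \<le> crude_const * (H ^ m * Z * (1 + ln Z) ^ k)"
      unfolding crude_const_def using H Z lnZ by (intro mult_right_mono) auto
    finally show ?thesis by (simp add: mult_ac)
  next
    case False
    define b where "b = (4 * Z powr \<epsilon> * (1 + ln Z)) ^ k"
    have "psi_err x h ^ k \<le> b" if x: "1 \<le> x" "x \<le> Z" for x
    proof -
      have "Z powr \<epsilon> \<le> Z powr 1" using Z eps by (intro powr_mono) auto
      then have "x + h \<le> 2 * Z" using False x Z by simp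
      then have "ln (x + h) \<le> ln (2 * Z)" using x assms by simp
      also have "\<dots> = ln 2 + ln Z" using Z by (simp add: ln_mult)
      also have "ln 2 \<le> (1::real)" using ln_2_less_1 by simp
      finally have l: "1 + ln (x + h) \<le> 2 * (1 + ln Z)" using lnZ by simp
      have "1 \<le> Z powr \<epsilon>" using Z eps by (simp add: ge_one_powr_ge_zero)
      then have "h + 1 \<le> 2 * Z powr \<epsilon>" using False by simp
      then have "(h + 1) * (1 + ln (x + h)) \<le> 2 * Z powr \<epsilon> * (2 * (1 + ln Z))"
        using l x assms lnZ by (intro mult_mono) auto
      then have "\<bar>psi_err x h\<bar> \<le> 4 * Z powr \<epsilon> * (1 + ln Z)"
        using psi_err_trivial_bound[of x h] x assms by (simp add: algebra_simps)
      then have "\<bar>psi_err x h\<bar> ^ k \<le> b" unfolding b_def by (intro power_mono) auto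
      then show ?thesis using k by (simp add: power_even_abs)
    qed
    then have "moment k Z h \<le> integral {1..Z} (\<lambda>_. b)"
      unfolding moment_def using assms by (intro integral_le psi_err_pow_integrable_const) auto
    also have "\<dots> = (Z - 1) * b" using Z by simp
    also have "\<dots> \<le> Z * b" using lnZ unfolding b_def by (intro mult_right_mono) auto
    also have "b = 4 ^ k * (Z powr (2 * \<epsilon>)) ^ m * (1 + ln Z) ^ k"
    proof -
      have "Z powr (2 * \<epsilon>) = (Z powr \<epsilon>) ^ 2"
        by (simp add: power2_eq_square flip: powr_add)
      then have "(Z powr (2 * \<epsilon>)) ^ m = (Z powr \<epsilon>) ^ k" using m(1) by (metis power_mult)
      then show ?thesis by (simp add: b_def power_mult_distrib)
    qed
    also have "Z * (4 ^ k * (Z powr (2 * \<epsilon>)) ^ m * (1 + ln Z) ^ k) \<le> Z * (crude_const * H ^ m * (1 + ln Z) ^ k)"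
      using Z lnZ assms H C mu_moment_nonneg[of k]
      by (intro mult_mono power_mono) (auto simp: crude_const_def)
    finally show ?thesis by (simp add: mult_ac)
  qed
qed

end

section \<open>Setting up the average over the length\<close>

lemma abs_mult_le_cancel:
  fixes a b c :: real
  assumes "0 < a" "\<bar>a * b\<bar> \<le> a * c"
  shows "\<bar>b\<bar> \<le> c"
  using assms by (simp add: abs_mult)

lemma power_diff_le_linear:
  fixes a b :: real
  assumes "0 \<le> a" "a \<le> b"
  shows "b ^ n - a ^ n \<le> real n * b ^ (n - 1) * (b - a)"
proof (induction n)
  case (Suc n)
  have "b ^ Suc n - a ^ Suc n = b * (b ^ n - a ^ n) + a ^ n * (b - a)"
    by (simp add: algebra_simps)
  also have "\<dots> \<le> b * (real n * b ^ (n - 1) * (b - a)) + b ^ n * (b - a)"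
    using assms Suc.IH by (intro add_mono mult_left_mono mult_right_mono power_mono) auto
  also have "\<dots> = real (Suc n) * b ^ (Suc n - 1) * (b - a)"
    by (cases n) (auto simp: algebra_simps)
  finally show ?case .
qed simp

text \<open>
  The implied constants of \<open>strip_asymp\<close>, of \<open>strip_top\<close> and of the conclusion. Their definitions precede
  the choice of \<open>X\<close> and \<open>\<delta>\<close>, on which they must not depend.
\<close>

context short_interval_moments
begin

definition strip_const :: real where
  "strip_const = 3 ^ (m + 1) * crude_const + 3 ^ m * \<mu> + 2 * real m * \<mu> + 2 * C"

definition top_const :: real where
  "top_const = 2 ^ m * (\<mu> + 2 * C)"

definition final_const :: real where
  "final_const = real k * 2 ^ k * (\<mu> + 2 * (strip_const + top_const) + 2 ^ (k + 1) * crude_const) + 2 * (strip_const + top_const)"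

end

text \<open>
  One pair \<open>X\<close>, \<open>\<delta>\<close> together with the width \<open>y\<close> in \<open>x\<close> of the strip; the lengths are averaged over
  \<open>[\<delta> x, \<delta> x + \<delta> y]\<close>. The last two assumptions hold for large \<open>X\<close>: \<open>\<delta>y\<close> makes the averaging window long
  enough for \<open>moment_crude\<close> at \<open>2 * X\<close>, and \<open>X_E\<close> makes \<open>E_const * \<delta>\<close> at most \<open>1 / 2\<close>, so that \<open>L\<close>
  below is positive.
\<close>

locale smoothing = short_interval_moments +
  fixes X y \<delta> :: real
  assumes y: "X0 \<le> y" "3 * y \<le> X"
    and \<delta>: "0 < \<delta>" "\<delta> \<le> X powr (- \<epsilon>) / 2"
    and \<delta>y: "(2 * X) powr (2 * \<epsilon>) \<le> \<delta> * y"
    and X_E: "E_const \<le> X powr \<epsilon>"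
begin

definition L :: real where "L = ln (1 / (E_const * \<delta>))"

text \<open>
  All powers of logarithms that occur in the error terms are bounded by \<open>T\<close>, and \<open>P\<close> is the power of
  the typical length \<open>\<delta> * X\<close> in the main term; the errors are thus compared with \<open>P * T * X\<close>.
\<close>

definition T :: real where "T = (1 + ln X) ^ k"

definition P :: real where "P = (\<delta> * X) ^ m"

text \<open>
  The contribution of one fixed length \<open>h\<close> to the averaged moment: the section at height \<open>h\<close> in
  \<open>integral_strip_swap\<close>.
\<close>

definition strip :: "real \<Rightarrow> real" where
  "strip h = integral {max 1 ((h - \<delta> * y) / \<delta>)..min X (h / \<delta>)} (\<lambda>x. psi_err x h ^ k)"

lemma X1: "1 \<le> y" "1 \<le> X" "y \<le> X" "3 \<le> X"
  using y X0 by auto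

lemma T1: "1 \<le> T"
  unfolding T_def using X1 by simp

lemma P_pos: "P > 0"
  unfolding P_def using X1 \<delta> by simp

lemma X_pow_le_\<delta>y: "x powr \<epsilon> \<le> \<delta> * y" if "1 \<le> x" "x \<le> X"
proof -
  have "x powr \<epsilon> \<le> (2 * X) powr \<epsilon>" using that eps by (intro powr_mono2) auto
  also have "\<dots> \<le> (2 * X) powr (2 * \<epsilon>)" using X1 eps by (intro powr_mono) auto
  finally show ?thesis using \<delta>y by linarith
qed

lemma \<delta>y_ge_1: "1 \<le> \<delta> * y"
  using X_pow_le_\<delta>y[of 1] X1 by simp

lemma \<delta>_le: "2 * \<delta> * x \<le> x powr (1 - \<epsilon>)" if "1 \<le> x" "x \<le> X"
proof -
  have "2 * \<delta> \<le> X powr (- \<epsilon>)" using \<delta> by simp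
  also have "\<dots> \<le> x powr (- \<epsilon>)" using that eps by (intro powr_mono2') auto
  finally have "x * (2 * \<delta>) \<le> x * x powr (- \<epsilon>)" using that by (intro mult_left_mono) auto
  also have "\<dots> = x powr (1 - \<epsilon>)" using that by (simp add: powr_diff powr_minus divide_simps)
  finally show ?thesis by (simp add: mult_ac)
qed

lemma E_le_inverse_\<delta>: "2 * E_const \<le> 1 / \<delta>"
proof -
  have "E_const * (2 * \<delta>) \<le> X powr \<epsilon> * X powr (- \<epsilon>)"
    using X_E \<delta> by (intro mult_mono) auto
  also have "\<dots> = 1" using X1 by (simp add: powr_minus field_simps)
  finally show ?thesis using \<delta> by (simp add: field_simps)
qed

lemma L_bounds: "0 \<le> L" "L \<le> ln X"
proof -
  have "1 \<le> 1 / (E_const * \<delta>)" using E_le_inverse_\<delta> \<delta> E_const_pos by (simp add: field_simps)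
  then show "0 \<le> L" unfolding L_def by (rule ln_ge_zero)
  have "1 * 1 \<le> E_const * (\<delta> * X)"
  proof (rule mult_mono)
    show "1 \<le> \<delta> * X" using \<delta>y_ge_1 mult_left_mono[OF X1(3), of \<delta>] \<delta> by linarith
  qed (use E_const_ge_1 in auto)
  then have "1 / (E_const * \<delta>) \<le> X" using E_const_pos \<delta> by (simp add: field_simps)
  then show "L \<le> ln X" unfolding L_def using E_const_pos \<delta> X1 by (intro ln_mono) auto
qed

lemma L_pow_le_T: "j \<le> k \<Longrightarrow> L ^ j \<le> T"
proof -
  assume "j \<le> k"
  have "L ^ j \<le> (1 + ln X) ^ j" using L_bounds by (intro power_mono) auto
  also have "\<dots> \<le> T" unfolding T_def using \<open>j \<le> k\<close> X1 by (intro power_increasing) auto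
  finally show ?thesis .
qed


section \<open>Moments over the strip for one fixed length\<close>

lemma strip_nonneg: "0 \<le> strip h"
  unfolding strip_def
  by (cases "(\<lambda>x. psi_err x h ^ k) integrable_on {max 1 ((h - \<delta> * y) / \<delta>)..min X (h / \<delta>)}")
     (auto intro!: integral_nonneg psi_err_pow_nonneg simp: not_integrable_integral)

lemma \<delta>y_pow: "(\<delta> * y) ^ m \<le> P * (y / X)"
proof -
  have "(\<delta> * y) ^ m = P * (y / X) ^ m"
    unfolding P_def power_mult_distrib[symmetric] using X1 by simp
  also have "(y / X) ^ m \<le> (y / X) ^ 1" using X1 m by (intro power_decreasing) auto
  finally show ?thesis using P_pos by (simp add: mult_left_mono)
qed

text \<open>
  For \<open>h\<close> this small the section lies in \<open>[1, 3 * y]\<close>, where the crude bound suffices: both the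
  range of \<open>x\<close> and the lengths are smaller than typical by the factor \<open>y / X\<close>.
\<close>

lemma strip_low:
  assumes "0 \<le> h" "h \<le> 3 * (\<delta> * y)"
  shows "strip h \<le> 3 ^ (m + 1) * crude_const * (P * T * (y ^ 2 / X))"
proof -
  have "strip h \<le> moment k (3 * y) h"
    unfolding strip_def moment_def
  proof (intro integral_subset_le psi_err_pow_integrable_const assms ballI psi_err_pow_nonneg)
    have "h / \<delta> \<le> 3 * y" using assms \<delta> by (simp add: field_simps)
    then show "{max 1 ((h - \<delta> * y) / \<delta>)..min X (h / \<delta>)} \<subseteq> {1..3 * y}" by auto
  qed
  also have "\<dots> \<le> crude_const * (3 * y) * (1 + ln (3 * y)) ^ k * (3 * (\<delta> * y)) ^ m"
  proof (rule moment_crude)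
    have "(3 * y) powr (2 * \<epsilon>) \<le> (2 * X) powr (2 * \<epsilon>)"
      using y X1 eps by (intro powr_mono2) auto
    then show "(3 * y) powr (2 * \<epsilon>) \<le> 3 * (\<delta> * y)" using \<delta>y \<delta>y_ge_1 by linarith
    show "h \<le> (3 * y) powr (1 - \<epsilon>)" using \<delta>_le[of "3 * y"] y X1 assms \<delta>y_ge_1 by simp
  qed (use y X1 assms in auto)
  also have "\<dots> \<le> crude_const * (3 * y) * T * (3 ^ m * (P * (y / X)))"
    unfolding T_def power_mult_distrib[of 3] using y X1 crude_const_nonneg P_pos \<delta>y_pow
    by (intro mult_mono power_mono) (auto simp: \<delta> less_imp_le)
  also have "\<dots> = 3 ^ (m + 1) * crude_const * (P * T * (y ^ 2 / X))"
    by (simp add: power2_eq_square field_simps)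
  finally show ?thesis .
qed

text \<open>
  Both ends \<open>x\<close> of a section satisfy \<open>\<delta> * x \<le> h \<le> \<delta> * x + \<delta> * y\<close>, and this puts \<open>h\<close> into the range
  of the hypothesis: such an \<open>h\<close> is at most \<open>2 * \<delta> * x\<close>, and the factor \<open>1 / 2\<close> in the upper
  bound on \<open>\<delta>\<close> leaves room for the \<open>2\<close>.
\<close>

lemma moment_endpoint:
  assumes "y \<le> x" "x \<le> X" "\<delta> * y \<le> h" "h \<le> \<delta> * x + \<delta> * y"
  shows "\<bar>moment k x h - moment_main k x h\<bar> \<le> C * (h ^ m * X powr (1 - \<epsilon>1))"
proof -
  have "\<delta> * y \<le> \<delta> * x" using assms \<delta> by (intro mult_left_mono) auto
  then have "h \<le> x powr (1 - \<epsilon>)" using \<delta>_le[of x] assms X1 by simp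
  moreover have "x powr \<epsilon> \<le> h" using X_pow_le_\<delta>y[of x] assms X1 by simp
  ultimately have "\<bar>moment k x h - moment_main k x h\<bar> \<le> C * (h ^ m * x powr (1 - \<epsilon>1))"
    using assms y by (intro asymp) auto
  also have "\<dots> \<le> C * (h ^ m * X powr (1 - \<epsilon>1))"
    using C assms \<delta>y_ge_1 eps X1 by (intro mult_left_mono powr_mono2) auto
  finally show ?thesis .
qed

text \<open>
  The section is an interval \<open>[x1, x2]\<close> with \<open>x1 \<ge> 2 * y\<close>, so its integral is the difference of the
  moments at \<open>x2\<close> and \<open>x1\<close>, and so is the main term. On \<open>[x1 / h, x2 / h]\<close> the variable of the
  logarithmic integral stays between \<open>2 / (3 * \<delta>)\<close> and \<open>1 / \<delta>\<close>.
\<close>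

lemma strip_high:
  assumes "3 * (\<delta> * y) \<le> h" "h \<le> \<delta> * X + \<delta> * y"
  defines "x1 \<equiv> h / \<delta> - y" and "x2 \<equiv> min X (h / \<delta>)"
  shows "\<bar>strip h - \<mu> * h ^ (m + 1) * integral {x1 / h..x2 / h} (\<lambda>x. ln (x / E_const) ^ m)\<bar>
           \<le> 2 * C * (h ^ m * X powr (1 - \<epsilon>1))"
    and "E_const \<le> x1 / h" "x1 / h \<le> x2 / h" "x2 / h \<le> 1 / \<delta>"
    and "(2 / 3) / \<delta> \<le> x1 / h"
proof -
  have h: "h > 0" using assms \<delta>y_ge_1 by linarith
  have hd: "3 * y \<le> h / \<delta>" "h / \<delta> \<le> X + y"
    using assms \<delta> by (auto simp: field_simps)
  have x12: "2 * y \<le> x1" "x1 \<le> x2" "x2 \<le> X"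
    using hd X1 by (auto simp: x1_def x2_def)
  show "x1 / h \<le> x2 / h" using x12 h by (simp add: divide_right_mono)
  have "x2 / h \<le> h / \<delta> / h" unfolding x2_def using h by (intro divide_right_mono) auto
  then show "x2 / h \<le> 1 / \<delta>" using h by simp
  have "(2 / 3) * (h / \<delta>) \<le> x1" using hd by (simp add: x1_def)
  then have "(2 / 3) * (h / \<delta>) / h \<le> x1 / h" using h by (intro divide_right_mono) auto
  then show x1h: "(2 / 3) / \<delta> \<le> x1 / h" using h by simp
  then show E: "E_const \<le> x1 / h" using E_le_inverse_\<delta> E_const_pos by simp
  have "(h - \<delta> * y) / \<delta> = x1" using \<delta> by (simp add: x1_def field_simps)
  then have "strip h = integral {x1..x2} (\<lambda>x. psi_err x h ^ k)"
    unfolding strip_def using x12 X1 by (simp add: x2_def max_def)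
  moreover have "moment k x1 h + integral {x1..x2} (\<lambda>x. psi_err x h ^ k) = moment k x2 h"
    unfolding moment_def
    by (rule Henstock_Kurzweil_Integration.integral_combine) (use x12 X1 h in auto)
  ultimately have strip: "strip h = moment k x2 h - moment k x1 h" by simp
  have "integral {E_const..x1 / h} (\<lambda>x. ln (x / E_const) ^ m)
      + integral {x1 / h..x2 / h} (\<lambda>x. ln (x / E_const) ^ m)
      = integral {E_const..x2 / h} (\<lambda>x. ln (x / E_const) ^ m)"
    using E \<open>x1 / h \<le> x2 / h\<close> E_const_pos by (intro Henstock_Kurzweil_Integration.integral_combine ln_pow_integrable)
  then have mid: "integral {x1 / h..x2 / h} (\<lambda>x. ln (x / E_const) ^ m)
      = integral {E_const..x2 / h} (\<lambda>x. ln (x / E_const) ^ m)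
        - integral {E_const..x1 / h} (\<lambda>x. ln (x / E_const) ^ m)" by simp
  then have main: "moment_main k x2 h - moment_main k x1 h =
      \<mu> * h ^ (m + 1) * integral {x1 / h..x2 / h} (\<lambda>x. ln (x / E_const) ^ m)"
    unfolding moment_main_def mid by (simp add: right_diff_distrib)
  have "h \<le> \<delta> * x1 + \<delta> * y" using \<delta> by (simp add: x1_def field_simps)
  moreover have "h \<le> \<delta> * x2 + \<delta> * y" using \<delta> assms(2) X1 by (auto simp: x2_def min_def field_simps)
  ultimately have "\<bar>moment k x1 h - moment_main k x1 h\<bar> \<le> C * (h ^ m * X powr (1 - \<epsilon>1))"
      "\<bar>moment k x2 h - moment_main k x2 h\<bar> \<le> C * (h ^ m * X powr (1 - \<epsilon>1))"
    using x12 X1 assms(1) \<delta>y_ge_1 by (auto intro!: moment_endpoint)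
  then show "\<bar>strip h - \<mu> * h ^ (m + 1) * integral {x1 / h..x2 / h} (\<lambda>x. ln (x / E_const) ^ m)\<bar>
      \<le> 2 * C * (h ^ m * X powr (1 - \<epsilon>1))"
    unfolding main[symmetric] strip by linarith
qed

text \<open>
  For \<open>h \<le> \<delta> * X\<close> the section is not truncated at \<open>X\<close>: \<open>[x1 / h, x2 / h]\<close> has length \<open>y / h\<close> and right
  end \<open>1 / \<delta>\<close>. Across it the logarithm drops from \<open>L\<close> by at most \<open>2 * \<delta> * y / h\<close>. Multiplied by
  \<open>h ^ m\<close> this is largest at \<open>h = \<delta> * X\<close>, so the bound can be stated without \<open>h\<close>.
\<close>

lemma strip_mid:
  assumes "3 * (\<delta> * y) \<le> h" "h \<le> \<delta> * X"
  shows "\<bar>strip h - \<mu> * h ^ m * y * L ^ m\<bar>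
     \<le> (2 * real m * \<mu> + 2 * C) * (P * T * (y ^ 2 / X + X powr (1 - \<epsilon>1)))"
proof -
  define x1 where "x1 = h / \<delta> - y"
  define x2 where "x2 = min X (h / \<delta>)"
  define J where "J = integral {x1 / h..x2 / h} (\<lambda>x. ln (x / E_const) ^ m)"
  define l where "l = ln (x1 / h / E_const)"
  have h: "h > 0" "h \<le> \<delta> * X + \<delta> * y" using assms \<delta>y_ge_1 by linarith+
  note high = strip_high[OF assms(1) h(2), folded x1_def x2_def, folded J_def]
  have x2: "x2 = h / \<delta>" using assms \<delta> by (simp add: x2_def min_def field_simps)
  have x21: "x2 / h - x1 / h = y / h" using h by (simp add: x1_def x2 diff_divide_distrib)
  have x2h: "x2 / h = 1 / \<delta>" using x2 h by simp
  have L: "L = ln (x2 / h / E_const)" unfolding L_def x2h by (simp add: mult.commute)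
  have x1pos: "0 < x1 / h" using high(2) E_const_pos by linarith
  have l: "0 \<le> l" "l \<le> L"
    unfolding l_def L using high(2,3) x1pos E_const_pos
    by (auto intro!: ln_ge_zero ln_mono divide_right_mono simp del: divide_divide_eq_left)
  have Ll: "L - l \<le> 2 * (\<delta> * y / h)"
  proof -
    have "L - l = ln ((x2 / h / E_const) / (x1 / h / E_const))"
      unfolding L l_def using x1pos E_const_pos high(3)
    by (subst ln_divide_pos) (simp_all del: divide_divide_eq_left)
    also have "(x2 / h / E_const) / (x1 / h / E_const) = x2 / h / (x1 / h)"
      using E_const_pos by simp
    also have "\<dots> = 1 + (y / h) / (x1 / h)"
    proof -
      have "(a + b) / a = 1 + b / a" if "0 < a" for a b :: real
        using that by (simp add: add_divide_distrib)
      from this[OF x1pos, of "y / h"] show ?thesis using x21 by (simp add: algebra_simps)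
    qed
    also have "ln \<dots> \<le> (y / h) / (x1 / h)"
    proof (rule ln_add_one_self_le_self)
      have "0 \<le> y / h" using X1 h by simp
      then show "0 \<le> (y / h) / (x1 / h)" using x1pos by (rule divide_nonneg_pos)
    qed
    also have "\<dots> \<le> (y / h) / ((1 / 2) / \<delta>)"
    proof (rule divide_left_mono)
      have "(1 / 2) / \<delta> \<le> (2 / 3) / \<delta>" using \<delta> by (intro divide_right_mono) auto
      then show "(1 / 2) / \<delta> \<le> x1 / h" using high(5) by linarith
      show "0 < x1 / h * ((1 / 2) / \<delta>)" using x1pos \<delta> by (intro mult_pos_pos) auto
    qed (use X1 h in auto)
    also have "\<dots> = 2 * (\<delta> * y / h)" by simp
    finally show ?thesis .
  qed
  have "\<bar>J - y / h * L ^ m\<bar> \<le> y / h * (L ^ m - l ^ m)"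
    using integral_ln_pow_bounds[OF high(2,3), of m]
    unfolding J_def[symmetric] x21 L[symmetric] l_def[symmetric] by (simp add: algebra_simps)
  also have "\<dots> \<le> y / h * (real m * L ^ (m - 1) * (L - l))"
    using l X1 h by (intro mult_left_mono power_diff_le_linear) auto
  also have "\<dots> \<le> y / h * (real m * T * (2 * (\<delta> * y / h)))"
    using l X1 h Ll L_pow_le_T[of "m - 1"] m T1 \<delta>
    by (intro mult_left_mono mult_mono) auto
  finally have J: "\<bar>J - y / h * L ^ m\<bar> \<le> y / h * (real m * T * (2 * (\<delta> * y / h)))" .
  have hP: "h ^ (m - 1) * \<delta> * X \<le> P"
  proof -
    have "h ^ (m - 1) * (\<delta> * X) \<le> (\<delta> * X) ^ (m - 1) * (\<delta> * X)"
      using assms h \<delta> X1 by (intro mult_right_mono power_mono) auto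
    also have "\<dots> = P" unfolding P_def using m by (metis power_minus_mult zero_less_one less_le_trans)
    finally show ?thesis by (simp add: mult_ac)
  qed
  have hP': "h ^ m \<le> P" unfolding P_def using assms h by (intro power_mono) auto
  have "\<bar>\<mu> * h ^ (m + 1) * J - \<mu> * h ^ m * y * L ^ m\<bar> = \<mu> * h ^ (m + 1) * \<bar>J - y / h * L ^ m\<bar>"
  proof -
    have "\<mu> * h ^ (m + 1) * J - \<mu> * h ^ m * y * L ^ m = \<mu> * h ^ (m + 1) * (J - y / h * L ^ m)"
      using h by (simp add: field_simps)
    then show ?thesis using h mu_moment_nonneg[of k] by (simp add: abs_mult)
  qed
  also have "\<dots> \<le> \<mu> * h ^ (m + 1) * (y / h * (real m * T * (2 * (\<delta> * y / h))))"
    using J h mu_moment_nonneg[of k] by (intro mult_left_mono) auto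
  also have "\<dots> = 2 * real m * \<mu> * ((h ^ (m - 1) * \<delta> * X) * T * (y ^ 2 / X))"
  proof -
    have "h ^ (m + 1) = h ^ (m - 1) * h ^ 2"
      using m by (simp flip: power_add)
    then show ?thesis using h X1 by (simp add: field_simps power2_eq_square)
  qed
  also have "\<dots> \<le> 2 * real m * \<mu> * (P * T * (y ^ 2 / X))"
    using hP T1 X1 mu_moment_nonneg[of k] by (intro mult_left_mono mult_right_mono) auto
  finally have 1: "\<bar>\<mu> * h ^ (m + 1) * J - \<mu> * h ^ m * y * L ^ m\<bar>
      \<le> 2 * real m * \<mu> * (P * T * (y ^ 2 / X))" .
  have "h ^ m * 1 * X powr (1 - \<epsilon>1) \<le> P * T * X powr (1 - \<epsilon>1)"
    using hP' T1 P_pos by (intro mult_mono) auto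
  then have 2: "2 * C * (h ^ m * X powr (1 - \<epsilon>1)) \<le> 2 * C * (P * T * X powr (1 - \<epsilon>1))"
    using C by (intro mult_left_mono) auto
  have "\<bar>strip h - \<mu> * h ^ m * y * L ^ m\<bar> \<le> 2 * real m * \<mu> * (P * T * (y ^ 2 / X))
      + 2 * C * (P * T * X powr (1 - \<epsilon>1))"
    using 1 2 high(1) by linarith
  also have "\<dots> \<le> (2 * real m * \<mu> + 2 * C) * (P * T * (y ^ 2 / X))
      + (2 * real m * \<mu> + 2 * C) * (P * T * X powr (1 - \<epsilon>1))"
    using C P_pos T1 X1 mu_moment_nonneg[of k] by (intro add_mono mult_right_mono) auto
  finally show ?thesis by (simp add: algebra_simps)
qed

text \<open>
  Beyond \<open>h = \<delta> * X\<close> the strip is cut off by \<open>x \<le> X\<close>. Only an upper bound is needed there, since the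
  range of these \<open>h\<close> has length \<open>\<delta> * y\<close>, a small part of the whole range.
\<close>

lemma strip_top:
  assumes "\<delta> * X \<le> h" "h \<le> \<delta> * X + \<delta> * y"
  shows "strip h \<le> 2 ^ m * (\<mu> + 2 * C) * (P * T * (y + X powr (1 - \<epsilon>1)))"
proof -
  define x1 where "x1 = h / \<delta> - y"
  define x2 where "x2 = min X (h / \<delta>)"
  define J where "J = integral {x1 / h..x2 / h} (\<lambda>x. ln (x / E_const) ^ m)"
  have "\<delta> * (3 * y) \<le> \<delta> * X" "\<delta> * y \<le> \<delta> * X" using y X1 \<delta> by (auto intro!: mult_left_mono)
  then have h3: "3 * (\<delta> * y) \<le> h" and h2: "h \<le> 2 * (\<delta> * X)" using assms by linarith+
  have h: "h > 0" using h3 \<delta>y_ge_1 by linarith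
  note high = strip_high[OF h3 assms(2), folded x1_def x2_def, folded J_def]
  have x2h: "1 \<le> x2 / h / E_const"
    using high(2,3) E_const_pos by (subst le_divide_eq_1_pos) auto
  then have "0 \<le> ln (x2 / h / E_const)" by (rule ln_ge_zero)
  moreover have "ln (x2 / h / E_const) \<le> L"
    unfolding L_def
  proof (rule ln_mono)
    have "x2 / h / E_const \<le> 1 / \<delta> / E_const"
      using high(4) E_const_pos by (intro divide_right_mono) auto
    then show "x2 / h / E_const \<le> 1 / (E_const * \<delta>)" by (simp add: mult.commute)
  qed (use x2h in linarith)
  ultimately have "ln (x2 / h / E_const) ^ m \<le> L ^ m" by (rule power_mono[rotated])
  also have "\<dots> \<le> T" using L_pow_le_T m by auto
  finally have "(x2 / h - x1 / h) * ln (x2 / h / E_const) ^ m \<le> (x2 / h - x1 / h) * T"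
    using high(3) by (intro mult_left_mono) auto
  also have "x2 / h - x1 / h \<le> y / h"
  proof -
    have "x2 - x1 \<le> y" by (simp add: x1_def x2_def)
    then show ?thesis using h divide_right_mono[of "x2 - x1" y h] by (simp add: diff_divide_distrib)
  qed
  then have "(x2 / h - x1 / h) * T \<le> y / h * T" using T1 by (intro mult_right_mono) auto
  finally have "J \<le> y / h * T"
    using integral_ln_pow_bounds(2)[OF high(2,3), of m] unfolding J_def by linarith
  then have "\<mu> * h ^ (m + 1) * J \<le> \<mu> * h ^ (m + 1) * (y / h * T)"
    using mu_moment_nonneg[of k] h by (intro mult_left_mono) auto
  also have "\<dots> = h ^ m * (\<mu> * y * T)" using h by (simp add: field_simps)
  finally have "strip h \<le> h ^ m * (\<mu> * y * T + 2 * C * X powr (1 - \<epsilon>1))"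
    using high(1) by (simp add: algebra_simps)
  also have "\<dots> \<le> h ^ m * ((\<mu> + 2 * C) * T * (y + X powr (1 - \<epsilon>1)))"
  proof -
    have "\<mu> * y * T + 2 * C * 1 * X powr (1 - \<epsilon>1) \<le> (\<mu> + 2 * C) * y * T + (\<mu> + 2 * C) * T * X powr (1 - \<epsilon>1)"
      using C T1 X1 mu_moment_nonneg[of k] by (intro add_mono mult_mono) auto
    also have "\<dots> = (\<mu> + 2 * C) * T * (y + X powr (1 - \<epsilon>1))" by (simp add: algebra_simps)
    finally show ?thesis using h by (intro mult_left_mono) auto
  qed
  also have "\<dots> \<le> (2 * (\<delta> * X)) ^ m * ((\<mu> + 2 * C) * T * (y + X powr (1 - \<epsilon>1)))"
    using h h2 C T1 X1 mu_moment_nonneg[of k]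
    by (intro mult_right_mono power_mono mult_nonneg_nonneg) auto
  also have "\<dots> = 2 ^ m * (\<mu> + 2 * C) * (P * T * (y + X powr (1 - \<epsilon>1)))"
    unfolding P_def power_mult_distrib[of 2] by (simp add: mult_ac)
  finally show ?thesis .
qed

text \<open>
  Below \<open>3 * (\<delta> * y)\<close> the main term and the integral are both small enough to be counted as error;
  hence a single bound serves for the whole range.
\<close>

lemma strip_asymp:
  assumes "0 \<le> h" "h \<le> \<delta> * X"
  shows "\<bar>strip h - \<mu> * h ^ m * y * L ^ m\<bar> \<le> strip_const * (P * T * (y ^ 2 / X + X powr (1 - \<epsilon>1)))"
proof (cases "3 * (\<delta> * y) \<le> h")
  case True
  note strip_mid[OF True assms(2)]
  also have "(2 * real m * \<mu> + 2 * C) * (P * T * (y ^ 2 / X + X powr (1 - \<epsilon>1)))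
      \<le> strip_const * (P * T * (y ^ 2 / X + X powr (1 - \<epsilon>1)))"
    using crude_const_nonneg P_pos T1 X1 mu_moment_nonneg[of k] by (intro mult_right_mono) (auto simp: strip_const_def)
  finally show ?thesis .
next
  case False
  then have h: "h \<le> 3 * (\<delta> * y)" by simp
  have "h ^ m \<le> (3 * (\<delta> * y)) ^ m" using assms h by (intro power_mono) auto
  also have "\<dots> \<le> 3 ^ m * (P * (y / X))"
    unfolding power_mult_distrib[of 3] using \<delta>y_pow by (intro mult_left_mono) auto
  finally have "\<mu> * h ^ m * y * L ^ m \<le> \<mu> * (3 ^ m * (P * (y / X))) * y * T"
    using L_pow_le_T[of m] L_bounds m mu_moment_nonneg[of k] X1 P_pos assms
    by (intro mult_mono) auto
  also have "\<dots> = 3 ^ m * \<mu> * (P * T * (y ^ 2 / X))"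
    by (simp add: power2_eq_square field_simps)
  finally have 1: "\<mu> * h ^ m * y * L ^ m \<le> 3 ^ m * \<mu> * (P * T * (y ^ 2 / X))" .
  have "0 \<le> \<mu> * h ^ m * y * L ^ m"
    using L_bounds mu_moment_nonneg[of k] X1 assms by simp
  then have "\<bar>strip h - \<mu> * h ^ m * y * L ^ m\<bar> \<le> 3 ^ (m + 1) * crude_const * (P * T * (y ^ 2 / X))
      + 3 ^ m * \<mu> * (P * T * (y ^ 2 / X))"
    using 1 strip_low[OF assms(1) h] strip_nonneg[of h] by linarith
  also have "\<dots> = (3 ^ (m + 1) * crude_const + 3 ^ m * \<mu>) * (P * T * (y ^ 2 / X))"
    by (simp add: algebra_simps)
  also have "\<dots> \<le> strip_const * (P * T * (y ^ 2 / X + X powr (1 - \<epsilon>1)))"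
    using crude_const_nonneg P_pos T1 X1 mu_moment_nonneg[of k] C
    by (intro mult_mono mult_left_mono) (auto simp: strip_const_def)
  finally show ?thesis .
qed

section \<open>The averaged moment and its distance to the moment sought\<close>

text \<open>
  The moment for the length \<open>\<delta> x + u\<close>; the one sought is \<open>shifted 0\<close>.
\<close>

definition shifted :: "real \<Rightarrow> real" where
  "shifted u = integral {1..X} (\<lambda>x. psi_err x (\<delta> * x + u) ^ k)"

lemma
  shows shifted_integrable: "shifted integrable_on {0..\<delta> * y}"
    and strip_integrable: "strip integrable_on {0..\<delta> * X + \<delta> * y}"
    and integral_shifted_eq: "integral {0..\<delta> * y} shifted = integral {0..\<delta> * X + \<delta> * y} strip"
proof -
  define R where "R = max X (\<delta> * X + \<delta> * y)"
  have meas: "(\<lambda>(x, h). psi_err x h ^ k) \<in> borel_measurable (borel \<Otimes>\<^sub>M borel)"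
    by measurable
  have bound: "\<bar>psi_err x h ^ k\<bar> \<le> (chebyshev_psi (2 * R) + R) ^ k"
    if "1 \<le> x" "x \<le> X" "0 \<le> h" "h \<le> \<delta> * X + \<delta> * y" for x h
    using that by (intro psi_err_pow_bounded) (auto simp: R_def)
  have pos: "0 \<le> (1 :: real)" "0 < \<delta>" "0 \<le> \<delta> * y" using \<delta> \<delta>y_ge_1 by auto
  note swap = integral_strip_swap[OF meas bound pos]
  show "shifted integrable_on {0..\<delta> * y}" "strip integrable_on {0..\<delta> * X + \<delta> * y}"
    "integral {0..\<delta> * y} shifted = integral {0..\<delta> * X + \<delta> * y} strip"
    unfolding shifted_def[abs_def] strip_def[abs_def] by (rule swap; assumption)+
qed

text \<open>
  The main term of the conclusion; it equals \<open>\<integral> \<mu> h ^ m y L ^ m dh\<close> over \<open>[0, \<delta> X]\<close>, divided by \<open>\<delta> y\<close>.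
\<close>

definition target :: real where
  "target = \<mu> / (real m + 1) * X ^ (m + 1) * \<delta> ^ m * L ^ m"

lemma target_le: "0 \<le> target" "target \<le> \<mu> * (P * T * X)"
proof -
  have eq: "target = \<mu> / (real m + 1) * (P * L ^ m * X)"
    by (simp add: target_def P_def power_mult_distrib mult_ac)
  show "0 \<le> target" unfolding target_def using X1 \<delta> L_bounds mu_moment_nonneg[of k] by simp
  have "\<mu> / (real m + 1) \<le> \<mu> / 1" using mu_moment_nonneg[of k] by (intro divide_left_mono) auto
  then show "target \<le> \<mu> * (P * T * X)"
    unfolding eq using P_pos X1 L_bounds L_pow_le_T[of m] m T1 mu_moment_nonneg[of k]
    by (intro mult_mono) auto
qed

text \<open>
  The error in \<open>strip_asymp\<close> is integrated over a range of length \<open>\<delta> * X\<close> and the bound in \<open>strip_top\<close>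
  over one of length \<open>\<delta> * y\<close>; with \<open>y \<le> X\<close> both amount to the same expression.
\<close>

lemma integral_shifted_asymp:
  "\<bar>integral {0..\<delta> * y} shifted - \<delta> * y * target\<bar>
     \<le> (strip_const + top_const) * (\<delta> * P * T * (y ^ 2 + X powr (2 - \<epsilon>1)))"
proof -
  have \<delta>X: "0 \<le> \<delta> * X" and \<delta>y0: "0 \<le> \<delta> * y" using \<delta> X1 by auto
  define Q where "Q = X powr (1 - \<epsilon>1)"
  have Q: "X * Q = X powr (2 - \<epsilon>1)" "y * Q \<le> X * Q" "0 \<le> Q"
  proof -
    have "X * Q = X powr (1 + (1 - \<epsilon>1))" unfolding Q_def powr_add using X1 by simp
    then show "X * Q = X powr (2 - \<epsilon>1)" by simp
  qed (use X1 in \<open>auto simp: Q_def mult_right_mono\<close>)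
  have int1: "strip integrable_on {0..\<delta> * X}"
    by (rule integrable_on_subinterval[OF strip_integrable]) (use \<delta>y0 in auto)
  have int2: "strip integrable_on {\<delta> * X..\<delta> * X + \<delta> * y}"
    by (rule integrable_on_subinterval[OF strip_integrable]) (use \<delta>X in auto)
  have split: "integral {0..\<delta> * y} shifted
      = integral {0..\<delta> * X} strip + integral {\<delta> * X..\<delta> * X + \<delta> * y} strip"
    unfolding integral_shifted_eq
    by (rule Henstock_Kurzweil_Integration.integral_combine[symmetric])
       (use \<delta>X \<delta>y0 strip_integrable in auto)
  define c where "c = \<mu> * y * L ^ m / real (m + 1)"
  have "((\<lambda>h. c * (real (m + 1) * h ^ m)) has_integral (c * (\<delta> * X) ^ (m + 1) - c * 0 ^ (m + 1))) {0..\<delta> * X}"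
  proof (rule fundamental_theorem_of_calculus[OF \<delta>X])
    fix h
    show "((\<lambda>h. c * h ^ (m + 1)) has_vector_derivative c * (real (m + 1) * h ^ m)) (at h within {0..\<delta> * X})"
      using DERIV_cmult[OF DERIV_pow[of "m + 1" h "{0..\<delta> * X}"], of c]
      by (simp add: has_real_derivative_iff_has_vector_derivative)
  qed
  also have "(\<lambda>h. c * (real (m + 1) * h ^ m)) = (\<lambda>h. \<mu> * h ^ m * y * L ^ m)"
    unfolding c_def by (auto simp del: of_nat_add)
  also have "c * (\<delta> * X) ^ (m + 1) - c * 0 ^ (m + 1) = \<delta> * y * target"
    by (simp add: c_def target_def power_mult_distrib mult_ac)
  finally have main: "((\<lambda>h. \<mu> * h ^ m * y * L ^ m) has_integral \<delta> * y * target) {0..\<delta> * X}" .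
  have "\<bar>integral {0..\<delta> * X} (\<lambda>h. strip h - \<mu> * h ^ m * y * L ^ m)\<bar>
      \<le> integral {0..\<delta> * X} (\<lambda>_. strip_const * (P * T * (y ^ 2 / X + Q)))"
    unfolding real_norm_def[symmetric] using strip_asymp int1 main
    by (intro integral_norm_bound_integral integrable_diff) (auto simp: Q_def)
  also have "\<dots> = strip_const * (\<delta> * P * T * (y ^ 2 + X powr (2 - \<epsilon>1)))"
    using \<delta>X X1 by (simp add: field_simps flip: Q(1))
  also have "integral {0..\<delta> * X} (\<lambda>h. strip h - \<mu> * h ^ m * y * L ^ m)
      = integral {0..\<delta> * X} strip - \<delta> * y * target"
    unfolding integral_unique[OF main, symmetric]
    by (rule Henstock_Kurzweil_Integration.integral_diff) (use int1 main in auto)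
  finally have 1: "\<bar>integral {0..\<delta> * X} strip - \<delta> * y * target\<bar>
      \<le> strip_const * (\<delta> * P * T * (y ^ 2 + X powr (2 - \<epsilon>1)))" .
  have "integral {\<delta> * X..\<delta> * X + \<delta> * y} strip
      \<le> integral {\<delta> * X..\<delta> * X + \<delta> * y} (\<lambda>_. top_const * (P * T * (y + Q)))"
    using int2 strip_top by (intro integral_le) (auto simp: top_const_def Q_def)
  also have "\<dots> = top_const * (\<delta> * P * T * (y ^ 2 + y * Q))"
    using \<delta>y0 by (simp add: algebra_simps power2_eq_square)
  also have "\<dots> \<le> top_const * (\<delta> * P * T * (y ^ 2 + X powr (2 - \<epsilon>1)))"
    using Q C mu_moment_nonneg[of k] \<delta> P_pos T1 by (intro mult_left_mono) (auto simp: top_const_def)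
  finally have 2: "integral {\<delta> * X..\<delta> * X + \<delta> * y} strip
      \<le> top_const * (\<delta> * P * T * (y ^ 2 + X powr (2 - \<epsilon>1)))" .
  have "0 \<le> integral {\<delta> * X..\<delta> * X + \<delta> * y} strip"
    using int2 strip_nonneg by (intro integral_nonneg) auto
  then show ?thesis using 1 2 unfolding split by (simp add: distrib_right)
qed

text \<open>
  The substitution \<open>x \<mapsto> (1 + \<delta>) * x\<close> turns this into a moment over an interval of fixed length \<open>u\<close>
  inside \<open>[1, 2 * X]\<close>.
\<close>

lemma moment_translate_le:
  assumes "0 \<le> u" "u \<le> \<delta> * y"
  shows "integral {1..X} (\<lambda>x. psi_err (x + \<delta> * x) u ^ k) \<le> 2 ^ (k + 1) * crude_const * (X * T * (\<delta> * y) ^ m)"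
proof -
  have "X powr (- \<epsilon>) \<le> X powr 0" using X1 eps by (intro powr_mono) auto
  then have \<delta>1: "\<delta> \<le> 1" using \<delta> X1 by simp
  have "integral {1..X} (\<lambda>x. psi_err (x + \<delta> * x) u ^ k)
      = integral ((\<lambda>x. x / (1 + \<delta>)) ` {1 + \<delta>..(1 + \<delta>) * X}) (\<lambda>x. psi_err ((1 + \<delta>) * x) u ^ k)"
  proof -
    have "(\<lambda>x. x / (1 + \<delta>)) ` {1 + \<delta>..(1 + \<delta>) * X} = {1..X}"
      using \<delta> X1 by (subst image_divide_atLeastAtMost) auto
    then show ?thesis by (simp add: algebra_simps)
  qed
  also have "\<dots> = (1 / \<bar>1 + \<delta>\<bar>) *\<^sub>R integral {1 + \<delta>..(1 + \<delta>) * X} (\<lambda>x. psi_err x u ^ k)"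
    using \<delta> by (intro integral_stretch_real) auto
  also have "\<dots> = integral {1 + \<delta>..(1 + \<delta>) * X} (\<lambda>x. psi_err x u ^ k) / (1 + \<delta>)"
    using \<delta> by simp
  also have "\<dots> \<le> integral {1 + \<delta>..(1 + \<delta>) * X} (\<lambda>x. psi_err x u ^ k) / 1"
    using \<delta> assms psi_err_pow_nonneg
    by (intro divide_left_mono integral_nonneg psi_err_pow_integrable_const) auto
  also have "\<dots> \<le> moment k (2 * X) u"
    unfolding moment_def div_by_1
  proof (intro integral_subset_le psi_err_pow_integrable_const assms ballI psi_err_pow_nonneg)
    have "(1 + \<delta>) * X \<le> 2 * X" using \<delta>1 X1 by (intro mult_right_mono) auto
    then show "{1 + \<delta>..(1 + \<delta>) * X} \<subseteq> {1..2 * X}" using \<delta> by auto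
  qed
  also have "\<dots> \<le> crude_const * (2 * X) * (1 + ln (2 * X)) ^ k * (\<delta> * y) ^ m"
  proof (rule moment_crude)
    have "\<delta> * y \<le> 2 * \<delta> * X" using X1 \<delta> by (simp add: mult_mono)
    also have "\<dots> \<le> X powr (1 - \<epsilon>)" using \<delta>_le[of X] X1 by simp
    also have "\<dots> \<le> (2 * X) powr (1 - \<epsilon>)" using X1 eps by (intro powr_mono2) auto
    finally show "u \<le> (2 * X) powr (1 - \<epsilon>)" using assms by simp
  qed (use assms y X1 \<delta>y in auto)
  also have "\<dots> \<le> crude_const * (2 * X) * (2 ^ k * T) * (\<delta> * y) ^ m"
  proof -
    have "ln (2 * X) = ln 2 + ln X" using X1 by (subst ln_mult_pos) auto
    then have "1 + ln (2 * X) \<le> 2 * (1 + ln X)"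
      using ln_2_less_1 ln_ge_zero[OF X1(2)] by argo
    then have "(1 + ln (2 * X)) ^ k \<le> 2 ^ k * T"
      unfolding T_def power_mult_distrib[symmetric] using X1 by (intro power_mono) auto
    then show ?thesis using crude_const_nonneg X1 \<delta> by (intro mult_right_mono mult_left_mono) auto
  qed
  finally show ?thesis by (simp add: mult_ac)
qed

text \<open>
  The decomposition \<open>f x (\<delta> x) = f x (\<delta> x + u) - f ((1 + \<delta>) x) u\<close> combined with
  \<open>power_diff_absorb\<close>. The bound for the second part is uniform in \<open>u\<close>, so only \<open>shifted u\<close> has to be
  averaged afterwards.
\<close>

lemma shifted_0_close:
  assumes "0 \<le> u" "u \<le> \<delta> * y" "0 < \<theta>" "\<theta> \<le> 1"
  shows "\<bar>shifted 0 - shifted u\<bar> \<le>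
    real k * 2 ^ k * (\<theta> * shifted u + 2 ^ (k + 1) * crude_const * (X * T * (\<delta> * y) ^ m) / \<theta> ^ k)"
proof -
  define R where "R = max (X + \<delta> * X) (\<delta> * X + \<delta> * y)"
  have \<delta>x: "0 \<le> \<delta> * x \<and> \<delta> * x \<le> \<delta> * X" if "1 \<le> x" "x \<le> X" for x
    using that \<delta> by auto
  have \<delta>y0: "0 \<le> \<delta> * y" using \<delta> X1 by simp
  have int: "(\<lambda>x. psi_err x (\<delta> * x + v) ^ k) integrable_on {1..X}" if "0 \<le> v" "v \<le> \<delta> * y" for v
    by (rule psi_err_pow_integrable[where R = R]) (use that \<delta>x in \<open>force simp: R_def\<close>)+
  have int': "(\<lambda>x. psi_err (x + \<delta> * x) u ^ k) integrable_on {1..X}"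
    by (rule psi_err_pow_integrable[where R = R]) (use assms \<delta>x in \<open>force simp: R_def\<close>)+
  let ?c = "real k * 2 ^ k"
  have "\<bar>integral {1..X} (\<lambda>x. psi_err x (\<delta> * x + 0) ^ k - psi_err x (\<delta> * x + u) ^ k)\<bar> \<le>
     integral {1..X} (\<lambda>x. ?c * (\<theta> * psi_err x (\<delta> * x + u) ^ k + psi_err (x + \<delta> * x) u ^ k / \<theta> ^ k))"
    unfolding real_norm_def[symmetric]
  proof (rule integral_norm_bound_integral)
    show "(\<lambda>x. psi_err x (\<delta> * x + 0) ^ k - psi_err x (\<delta> * x + u) ^ k) integrable_on {1..X}"
      using int[of 0] int[of u] assms \<delta>y0 by (intro integrable_diff) auto
    show "(\<lambda>x. ?c * (\<theta> * psi_err x (\<delta> * x + u) ^ k + psi_err (x + \<delta> * x) u ^ k / \<theta> ^ k)) integrable_on {1..X}"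
      using int[of u] int' assms by (intro integrable_on_mult_right integrable_add integrable_on_divide) auto
    fix x assume "x \<in> {1..X}"
    \<comment> \<open>The interval of length \<open>\<delta> x + u\<close> from \<open>x\<close> is the one of length \<open>\<delta> x\<close> followed by one of length \<open>u\<close>.\<close>
    have "psi_err x (\<delta> * x + 0) = psi_err x (\<delta> * x + u) - psi_err (x + \<delta> * x) u"
      by (simp add: psi_err_def algebra_simps)
    then show "norm (psi_err x (\<delta> * x + 0) ^ k - psi_err x (\<delta> * x + u) ^ k) \<le>
        ?c * (\<theta> * psi_err x (\<delta> * x + u) ^ k + psi_err (x + \<delta> * x) u ^ k / \<theta> ^ k)"
      using power_diff_absorb[OF k assms(3,4)] by simp
  qed
  also have "integral {1..X} (\<lambda>x. psi_err x (\<delta> * x + 0) ^ k - psi_err x (\<delta> * x + u) ^ k) = shifted 0 - shifted u"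
    unfolding shifted_def using int[of 0] int[of u] assms \<delta>y0 by (intro integral_diff) auto
  also have "integral {1..X} (\<lambda>x. ?c * (\<theta> * psi_err x (\<delta> * x + u) ^ k + psi_err (x + \<delta> * x) u ^ k / \<theta> ^ k))
      = ?c * (\<theta> * shifted u + integral {1..X} (\<lambda>x. psi_err (x + \<delta> * x) u ^ k) / \<theta> ^ k)"
    unfolding shifted_def using int[of u] int' assms
    by (simp add: integral_add integrable_on_mult_right integrable_on_divide del: power_divide)
  also have "\<dots> \<le> ?c * (\<theta> * shifted u + 2 ^ (k + 1) * crude_const * (X * T * (\<delta> * y) ^ m) / \<theta> ^ k)"
    using moment_translate_le[OF assms(1,2)] assms
    by (intro mult_left_mono add_left_mono divide_right_mono) auto
  finally show ?thesis .
qed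

lemma shifted_0_average:
  assumes "0 < \<theta>" "\<theta> \<le> 1"
  defines "A \<equiv> integral {0..\<delta> * y} shifted / (\<delta> * y)"
  shows "\<bar>shifted 0 - A\<bar> \<le>
    real k * 2 ^ k * (\<theta> * A + 2 ^ (k + 1) * crude_const * (X * T * (\<delta> * y) ^ m) / \<theta> ^ k)"
proof -
  let ?c = "real k * 2 ^ k" and ?B = "2 ^ (k + 1) * crude_const * (X * T * (\<delta> * y) ^ m) / \<theta> ^ k"
  have \<delta>y0: "0 < \<delta> * y" using \<delta> X1 by simp
  have "\<bar>integral {0..\<delta> * y} (\<lambda>u. shifted 0 - shifted u)\<bar>
      \<le> integral {0..\<delta> * y} (\<lambda>u. ?c * (\<theta> * shifted u + ?B))"
    unfolding real_norm_def[symmetric]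
    using shifted_integrable shifted_0_close[OF _ _ assms(1,2)]
    by (intro integral_norm_bound_integral integrable_diff integrable_on_mult_right integrable_add) auto
  also have "integral {0..\<delta> * y} (\<lambda>u. shifted 0 - shifted u) = \<delta> * y * shifted 0 - integral {0..\<delta> * y} shifted"
    using shifted_integrable \<delta>y0 by (subst integral_diff) auto
  also have "integral {0..\<delta> * y} (\<lambda>u. ?c * (\<theta> * shifted u + ?B))
      = ?c * (\<theta> * integral {0..\<delta> * y} shifted + \<delta> * y * ?B)"
    using shifted_integrable \<delta>y0
    by (subst integral_mult_right, subst Henstock_Kurzweil_Integration.integral_add)
       (auto intro!: integrable_on_mult_right)
  also have "integral {0..\<delta> * y} shifted = \<delta> * y * A" using \<delta>y0 by (simp add: A_def)
  also have "\<delta> * y * shifted 0 - \<delta> * y * A = \<delta> * y * (shifted 0 - A)" by (simp add: algebra_simps)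
  also have "?c * (\<theta> * (\<delta> * y * A) + \<delta> * y * ?B) = \<delta> * y * (?c * (\<theta> * A + ?B))"
    by (simp add: algebra_simps)
  finally show ?thesis by (rule abs_mult_le_cancel[OF \<delta>y0])
qed

text \<open>
  The choice \<open>y = X powr (1 - \<epsilon>1 / 2)\<close> equalises the errors \<open>y ^ 2\<close> and \<open>X powr (2 - \<epsilon>1)\<close> in
  \<open>integral_shifted_asymp\<close>. In \<open>shifted_0_average\<close> take \<open>\<theta> = z\<close> with \<open>z = X powr (- (\<epsilon>1 / 8))\<close>: since
  \<open>y / X = z ^ 4\<close> and \<open>k = 2 m\<close>, the second error there is smaller than \<open>P\<close> by \<open>z ^ (4 m - k) = z ^ k\<close>.
\<close>

lemma shifted_0_asymp:
  assumes y_eq: "y = X powr (1 - \<epsilon>1 / 2)"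
  shows "\<bar>shifted 0 - target\<bar> \<le> final_const * (P * T * X * X powr (- (\<epsilon>1 / 8)))"
proof -
  define z where "z = X powr (- (\<epsilon>1 / 8))"
  define W where "W = P * T * X"
  define A where "A = integral {0..\<delta> * y} shifted / (\<delta> * y)"
  define c where "c = strip_const + top_const"
  have z: "0 < z" "z \<le> 1"
    using X1 eps powr_mono[of "- (\<epsilon>1 / 8)" 0 X] by (auto simp: z_def)
  have W: "0 \<le> W" using P_pos T1 X1 by (simp add: W_def)
  have c: "0 \<le> c" unfolding c_def strip_const_def top_const_def using crude_const_nonneg mu_moment_nonneg[of k] C by simp
  have \<delta>y0: "0 < \<delta> * y" using \<delta> X1 by simp
  have yX: "y = X * z ^ 4"
  proof -
    have "z ^ 4 = X powr (- (\<epsilon>1 / 2))" using X1 by (simp add: z_def powr_power)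
    then show ?thesis using X1 by (simp add: y_eq powr_diff powr_minus_divide)
  qed
  have y2: "y ^ 2 = X powr (2 - \<epsilon>1)"
    using X1 by (simp add: y_eq powr_power algebra_simps)
  have z4: "z ^ 4 \<le> z" using z power_decreasing[of 1 4 z] by simp
  have "\<delta> * y * A = integral {0..\<delta> * y} shifted" using \<delta>y0 by (simp add: A_def)
  then have "\<bar>\<delta> * y * (A - target)\<bar> \<le> c * (\<delta> * P * T * (2 * y ^ 2))"
    using integral_shifted_asymp by (simp add: c_def y2 right_diff_distrib)
  also have "\<dots> = \<delta> * y * (2 * c * (P * T * y))" by (simp add: power2_eq_square)
  finally have "\<bar>A - target\<bar> \<le> 2 * c * (P * T * y)"
    by (rule abs_mult_le_cancel[OF \<delta>y0])
  also have "\<dots> = 2 * c * (W * z ^ 4)" by (simp add: W_def yX)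
  also have "\<dots> \<le> 2 * c * (W * z)" using z4 c W by (intro mult_left_mono) auto
  finally have 1: "\<bar>A - target\<bar> \<le> 2 * c * (W * z)" .
  have "2 * c * (W * z) \<le> 2 * c * (W * 1)" using z c W by (intro mult_left_mono) auto
  then have A: "A \<le> (\<mu> + 2 * c) * W"
    using 1 target_le(2) unfolding W_def[symmetric] by (simp add: algebra_simps)
  have "(\<delta> * y) ^ m / z ^ k = P * ((z ^ 4) ^ m / z ^ k)"
    unfolding yX P_def by (simp add: power_mult_distrib)
  also have "(z ^ 4) ^ m = z ^ k * z ^ k"
  proof -
    have "4 * m = k + k" using m(1) by linarith
    then show ?thesis by (metis power_mult power_add)
  qed
  also have "z ^ k * z ^ k / z ^ k = z ^ k" using z by simp
  also have "P * z ^ k \<le> P * z"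
    using P_pos z k power_decreasing[of 1 k z] by (intro mult_left_mono) auto
  finally have "X * T * ((\<delta> * y) ^ m / z ^ k) \<le> X * T * (P * z)"
    using X1 T1 by (intro mult_left_mono) auto
  then have B: "2 ^ (k + 1) * crude_const * (X * T * (\<delta> * y) ^ m) / z ^ k \<le> 2 ^ (k + 1) * crude_const * (W * z)"
    using crude_const_nonneg mult_left_mono[of "X * T * ((\<delta> * y) ^ m / z ^ k)" "X * T * (P * z)" "2 ^ (k + 1) * crude_const"]
    by (simp add: W_def mult_ac)
  have "\<bar>shifted 0 - A\<bar> \<le> real k * 2 ^ k * (z * A + 2 ^ (k + 1) * crude_const * (X * T * (\<delta> * y) ^ m) / z ^ k)"
    unfolding A_def by (rule shifted_0_average[OF z])
  also have "\<dots> \<le> real k * 2 ^ k * (z * ((\<mu> + 2 * c) * W) + 2 ^ (k + 1) * crude_const * (W * z))"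
    using A B z by (intro mult_left_mono add_mono) auto
  finally have "\<bar>shifted 0 - target\<bar> \<le>
      real k * 2 ^ k * (z * ((\<mu> + 2 * c) * W) + 2 ^ (k + 1) * crude_const * (W * z)) + 2 * c * (W * z)"
    using 1 by linarith
  also have "\<dots> = final_const * (W * z)" unfolding final_const_def c_def by (simp add: algebra_simps)
  finally show ?thesis by (simp add: W_def z_def)
qed

end

section \<open>From fixed lengths to lengths proportional to the starting point\<close>

text \<open>
  The value \<open>1 / 2\<close> serves as \<open>\<epsilon>0\<close> for every \<open>k\<close>. The exponent \<open>\<epsilon>2 = \<epsilon>1 / 16\<close> is half of the saving
  in \<open>shifted_0_asymp\<close>; the other half pays for the logarithms in \<open>T\<close>.
\<close>

theorem theorem3p1:
  fixes k :: nat
  assumes RH: "Riemann_Hypothesis"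
    and k: "even k" "k > 0"
  shows "\<exists>\<epsilon>0 :: real. \<epsilon>0 > 0 \<and>
    (\<forall>\<epsilon> \<epsilon>1 :: real. \<epsilon>0 > \<epsilon> \<and> \<epsilon> > \<epsilon>1 \<and> \<epsilon>1 > 0 \<longrightarrow>
      (\<exists>C X0 :: real. \<forall>X h :: real. X \<ge> X0 \<and> X \<ge> 1 \<and> X powr \<epsilon> \<le> h \<and> h \<le> X powr (1 - \<epsilon>) \<longrightarrow>
         \<bar>integral {1..X} (\<lambda>x. (chebyshev_psi (x + h) - chebyshev_psi x - h) ^ k)
            - mu_moment k * h ^ (k div 2 + 1)
              * integral {E_const..X / h} (\<lambda>x. ln (x / E_const) ^ (k div 2))\<bar>
         \<le> C * (h ^ (k div 2) * X powr (1 - \<epsilon>1)))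
      \<longrightarrow>
      (\<exists>\<epsilon>2 :: real. \<epsilon>2 > 0 \<and>
        (\<exists>C X0 :: real. \<forall>X \<delta> :: real. X \<ge> X0 \<and> X \<ge> 1 \<and>
             X powr (- 1 + 2 * \<epsilon> + 2 * \<epsilon>1) \<le> \<delta> \<and> \<delta> \<le> X powr (- \<epsilon>) / 2 \<longrightarrow>
           \<bar>integral {1..X} (\<lambda>x. (chebyshev_psi (x + \<delta> * x) - chebyshev_psi x - \<delta> * x) ^ k)
              - mu_moment k / (real k / 2 + 1) * X ^ (k div 2 + 1) * \<delta> ^ (k div 2)
                * ln (1 / (E_const * \<delta>)) ^ (k div 2)\<bar>
           \<le> C * (\<delta> ^ (k div 2) * X powr (real k / 2 + 1 - \<epsilon>2)))))"
proof (rule exI[of _ "1 / 2"], rule conjI[rotated], intro allI impI)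
  fix \<epsilon> \<epsilon>1 :: real
  assume "1 / 2 > \<epsilon> \<and> \<epsilon> > \<epsilon>1 \<and> \<epsilon>1 > 0"
  then have eps: "\<epsilon> < 1 / 2" "\<epsilon>1 < \<epsilon>" "0 < \<epsilon>1" by auto
  assume "\<exists>C X0 :: real. \<forall>X h :: real. X \<ge> X0 \<and> X \<ge> 1 \<and> X powr \<epsilon> \<le> h \<and> h \<le> X powr (1 - \<epsilon>) \<longrightarrow>
         \<bar>integral {1..X} (\<lambda>x. (chebyshev_psi (x + h) - chebyshev_psi x - h) ^ k)
            - mu_moment k * h ^ (k div 2 + 1)
              * integral {E_const..X / h} (\<lambda>x. ln (x / E_const) ^ (k div 2))\<bar>
         \<le> C * (h ^ (k div 2) * X powr (1 - \<epsilon>1))"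
  then obtain C0 N :: real where hyp: "\<And>X h. X \<ge> N \<Longrightarrow> X \<ge> 1 \<Longrightarrow> X powr \<epsilon> \<le> h \<Longrightarrow> h \<le> X powr (1 - \<epsilon>) \<Longrightarrow>
         \<bar>moment k X h - moment_main k X h\<bar> \<le> C0 * (h ^ (k div 2) * X powr (1 - \<epsilon>1))"
    unfolding moment_def moment_main_def psi_err_def by blast
  interpret short_interval_moments k \<epsilon> \<epsilon>1 "max C0 0" "max N 1"
  proof
    fix X h assume X: "max N 1 \<le> X" and h: "X powr \<epsilon> \<le> h" "h \<le> X powr (1 - \<epsilon>)"
    have "0 \<le> h" using h(1) powr_ge_zero[of X \<epsilon>] by linarith
    then have "C0 * (h ^ (k div 2) * X powr (1 - \<epsilon>1)) \<le> max C0 0 * (h ^ (k div 2) * X powr (1 - \<epsilon>1))"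
      by (intro mult_right_mono) auto
    then show "\<bar>moment k X h - moment_main k X h\<bar> \<le> max C0 0 * (h ^ (k div 2) * X powr (1 - \<epsilon>1))"
      using hyp[of X h] X h by simp
  qed (use k eps in auto)
  have ev: "\<forall>\<^sub>F X in at_top. c \<le> X powr e" "\<forall>\<^sub>F X in at_top. 3 * X powr (1 - e) \<le> X"
      "\<forall>\<^sub>F X in at_top. 1 + ln X \<le> X powr e" if "0 < e" for c e :: real
    using that by real_asymp+
  \<comment> \<open>For the fourth: \<open>(2 * X) powr (2 * \<epsilon>)\<close> has to stay below the product of the least \<open>\<delta>\<close> and \<open>y\<close>,
    whose exponent is \<open>2 * \<epsilon> + 3 * \<epsilon>1 / 2\<close>. The last one makes \<open>T\<close> at most \<open>X powr (\<epsilon>1 / 16)\<close>.\<close>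
  have "\<forall>\<^sub>F X in at_top. max N 1 \<le> X powr (1 - \<epsilon>1 / 2)" "\<forall>\<^sub>F X in at_top. 3 * X powr (1 - \<epsilon>1 / 2) \<le> X"
    "\<forall>\<^sub>F X in at_top. E_const \<le> X powr \<epsilon>" "\<forall>\<^sub>F X in at_top. 2 powr (2 * \<epsilon>) \<le> X powr (3 * \<epsilon>1 / 2)"
    "\<forall>\<^sub>F X in at_top. 1 + ln X \<le> X powr (\<epsilon>1 / 16 / real k)"
    using eps k by (intro ev; simp)+
  then have "\<forall>\<^sub>F X in at_top. max N 1 \<le> X powr (1 - \<epsilon>1 / 2) \<and> 3 * X powr (1 - \<epsilon>1 / 2) \<le> X \<and>
      E_const \<le> X powr \<epsilon> \<and> 2 powr (2 * \<epsilon>) \<le> X powr (3 * \<epsilon>1 / 2) \<and> 1 + ln X \<le> X powr (\<epsilon>1 / 16 / real k)"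
    by eventually_elim auto
  then obtain X1 where X1: "max N 1 \<le> X powr (1 - \<epsilon>1 / 2)" "3 * X powr (1 - \<epsilon>1 / 2) \<le> X"
      "E_const \<le> X powr \<epsilon>" "2 powr (2 * \<epsilon>) \<le> X powr (3 * \<epsilon>1 / 2)" "1 + ln X \<le> X powr (\<epsilon>1 / 16 / real k)"
    if "X1 \<le> X" for X
    by (auto simp: eventually_at_top_linorder)
  show "\<exists>\<epsilon>2 :: real. \<epsilon>2 > 0 \<and>
        (\<exists>C X0 :: real. \<forall>X \<delta> :: real. X \<ge> X0 \<and> X \<ge> 1 \<and>
             X powr (- 1 + 2 * \<epsilon> + 2 * \<epsilon>1) \<le> \<delta> \<and> \<delta> \<le> X powr (- \<epsilon>) / 2 \<longrightarrow>
           \<bar>integral {1..X} (\<lambda>x. (chebyshev_psi (x + \<delta> * x) - chebyshev_psi x - \<delta> * x) ^ k)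
              - mu_moment k / (real k / 2 + 1) * X ^ (k div 2 + 1) * \<delta> ^ (k div 2)
                * ln (1 / (E_const * \<delta>)) ^ (k div 2)\<bar>
           \<le> C * (\<delta> ^ (k div 2) * X powr (real k / 2 + 1 - \<epsilon>2)))"
  proof (rule exI[of _ "\<epsilon>1 / 16"], rule conjI[rotated], rule exI[of _ final_const], rule exI[of _ X1], intro allI impI)
    fix X \<delta> :: real
    assume "X \<ge> X1 \<and> X \<ge> 1 \<and> X powr (- 1 + 2 * \<epsilon> + 2 * \<epsilon>1) \<le> \<delta> \<and> \<delta> \<le> X powr (- \<epsilon>) / 2"
    then have X: "X1 \<le> X" "1 \<le> X"
      and \<delta>: "X powr (- 1 + 2 * \<epsilon> + 2 * \<epsilon>1) \<le> \<delta>" "\<delta> \<le> X powr (- \<epsilon>) / 2" by auto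
    note large = X1[OF X(1)]
    have \<delta>0: "0 < \<delta>" using \<delta>(1) X by (smt (verit) powr_gt_zero)
    interpret smoothing k \<epsilon> \<epsilon>1 "max C0 0" "max N 1" X "X powr (1 - \<epsilon>1 / 2)" \<delta>
    proof
      have "(2 * X) powr (2 * \<epsilon>) = 2 powr (2 * \<epsilon>) * X powr (2 * \<epsilon>)"
        using X by (simp add: powr_mult)
      also have "\<dots> \<le> X powr (3 * \<epsilon>1 / 2) * X powr (2 * \<epsilon>)"
        using large by (intro mult_right_mono) auto
      also have "\<dots> = X powr (- 1 + 2 * \<epsilon> + 2 * \<epsilon>1) * X powr (1 - \<epsilon>1 / 2)"
        by (simp add: algebra_simps flip: powr_add)
      also have "\<dots> \<le> \<delta> * X powr (1 - \<epsilon>1 / 2)"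
        using \<delta> by (intro mult_right_mono) auto
      finally show "(2 * X) powr (2 * \<epsilon>) \<le> \<delta> * X powr (1 - \<epsilon>1 / 2)" .
    qed (use large \<delta> \<delta>0 in auto)
    have m_real: "real k / 2 = real m" using m(1) by simp
    have final_const: "0 \<le> final_const"
      unfolding final_const_def strip_const_def top_const_def using crude_const_nonneg mu_moment_nonneg[of k] by simp
    have "T \<le> (X powr (\<epsilon>1 / 16 / real k)) ^ k"
      unfolding T_def using large X by (intro power_mono) auto
    also have "\<dots> = X powr (\<epsilon>1 / 16)" using X k by (simp add: powr_power)
    finally have T: "T \<le> X powr (\<epsilon>1 / 16)" .
    have "P * T * X * X powr (- (\<epsilon>1 / 8)) \<le> P * X powr (\<epsilon>1 / 16) * X * X powr (- (\<epsilon>1 / 8))"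
      using T P_pos X by (intro mult_right_mono mult_left_mono) auto
    also have "\<dots> = \<delta> ^ m * (X ^ (m + 1) * (X powr (\<epsilon>1 / 16) * X powr (- (\<epsilon>1 / 8))))"
      by (simp add: P_def power_mult_distrib mult_ac)
    also have "X ^ (m + 1) = X powr (real k / 2 + 1)"
      using X by (simp add: m_real powr_add powr_realpow)
    also have "X powr (real k / 2 + 1) * (X powr (\<epsilon>1 / 16) * X powr (- (\<epsilon>1 / 8)))
        = X powr (real k / 2 + 1 - \<epsilon>1 / 16)"
      by (simp flip: powr_add)
    finally have "final_const * (P * T * X * X powr (- (\<epsilon>1 / 8))) \<le> final_const * (\<delta> ^ m * X powr (real k / 2 + 1 - \<epsilon>1 / 16))"
      using final_const by (rule mult_left_mono)
    then have close: "\<bar>shifted 0 - target\<bar> \<le> final_const * (\<delta> ^ m * X powr (real k / 2 + 1 - \<epsilon>1 / 16))"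
      using shifted_0_asymp[OF refl] by linarith
    show "\<bar>integral {1..X} (\<lambda>x. (chebyshev_psi (x + \<delta> * x) - chebyshev_psi x - \<delta> * x) ^ k)
              - mu_moment k / (real k / 2 + 1) * X ^ (k div 2 + 1) * \<delta> ^ (k div 2)
                * ln (1 / (E_const * \<delta>)) ^ (k div 2)\<bar>
           \<le> final_const * (\<delta> ^ (k div 2) * X powr (real k / 2 + 1 - \<epsilon>1 / 16))"
      using close unfolding shifted_def target_def psi_err_def L_def m_real add_0_right .
  qed (use eps in simp)
qed simp

end
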